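(* Let $\mathbf v(\mathbf x)$, $p(\mathbf x)$ be solution fields of the porous-media flow equations in the context, where the drag coefficient $\alpha$ is allowed to depend on the solution fields $\mathbf v(\mathbf x)$ and $p(\mathbf x)$. Then, for all $\delta\mathbf v\in\mathcal V_0$ and all $\delta p$, the first variation of the functional $\widehat\Psi$ at $(\mathbf v,p)$ is $$\delta\widehat\Psi[\mathbf v(\mathbf x),p(\mathbf x)]\cdot(\delta\mathbf v(\mathbf x),\delta p(\mathbf x))=\int_\Omega\frac12\left(\frac{\partial\alpha}{\partial\mathbf v}\cdot\delta\mathbf v+\frac{\partial\alpha}{\partial p}\cdot\delta p\right)\mathbf v(\mathbf x)\cdot\mathbf v(\mathbf x)\,\mathrm d\Omega .$$ For this integral to vanish for all $\delta\mathbf v\in\mathcal V_0$ and all $\delta p$ (the necessary condition for the solution fields to satisfy the minimum power theorem), we must have $$\frac{\partial\alpha}{\partial\mathbf v}=\mathbf 0\quad\text{and}\quad\frac{\partial\alpha}{\partial p}=0,$$ meaning that the drag function is independent of the solution fields. Hence the necessary condition is not met if $\alpha$ depends on the solution fields, and the minimum power theorem does not hold for nonlinear models such as the Darcy-Forchheimer and Barus models.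
   Context: $\Omega$ is the domain, with boundary $\partial\Omega$ divided into two complementary parts $\Gamma^v$ and $\Gamma^p$; $\widehat{\mathbf n}$ is the unit outward normal. The data are the fluid density $\rho$, the specific body force $\mathbf b(\mathbf x)$, the prescribed normal component of velocity $v_n(\mathbf x)$ on $\Gamma^v$ and the prescribed pressure $p_0(\mathbf x)$ on $\Gamma^p$. The flow equations for the velocity $\mathbf v$ and pressure $p$ are $$\alpha\mathbf v+\mathrm{grad}[p]=\rho\mathbf b\ \text{ in }\Omega,\qquad \mathrm{div}[\mathbf v]=0\ \text{ in }\Omega,\qquad \mathbf v\cdot\widehat{\mathbf n}=v_n\ \text{ on }\Gamma^v,\qquad p=p_0\ \text{ on }\Gamma^p,$$ where $\alpha$ is the drag coefficient. With $k(\mathbf x)$ the permeability: the Darcy model has $\alpha=\mu/k(\mathbf x)$ with constant viscosity $\mu$, independent of $\mathbf v$ and $p$; the Barus model has $\alpha=\frac{\mu_0}{k(\mathbf x)}\exp[\beta_{\mathrm B}p]$, where $\mu_0$ is a constant (the viscosity at a reference pressure) and $\beta_{\mathrm B}$ is a characteristic coefficient of the fluid; the Darcy-Forchheimer model has $\alpha=\frac{\mu}{k(\mathbf x)}(1+\beta_{\mathrm F}\|\mathbf v\|)$, where $\beta_{\mathrm F}$ is the Forchheimer coefficient and $\|\cdot\|$ is the Euclidean norm. (The Barus and Darcy-Forchheimer models reduce to the Darcy model when $\beta_{\mathrm B}=0$ and $\beta_{\mathrm F}=0$, respectively.) Define $$\mathcal V:=\{\mathbf w(\mathbf x)\mid \mathbf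 w\cdot\widehat{\mathbf n}=v_n\text{ on }\Gamma^v\},\qquad \mathcal V_0:=\{\mathbf w(\mathbf x)\mid\mathbf w\cdot\widehat{\mathbf n}=0\text{ on }\Gamma^v\},$$ and the space of kinematically admissible fields $$\mathcal K:=\{\widetilde{\mathbf v}(\mathbf x)\mid \mathrm{div}[\widetilde{\mathbf v}]=0\text{ in }\Omega,\ \widetilde{\mathbf v}\cdot\widehat{\mathbf n}=v_n\text{ on }\Gamma^v\}.$$ The mechanical power functional is $$\Psi[\mathbf w]:=\int_\Omega\frac12\,\alpha\,\mathbf w\cdot\mathbf w\,\mathrm d\Omega-\int_\Omega\mathbf w\cdot\rho\mathbf b\,\mathrm d\Omega+\int_{\Gamma^p}\mathbf w\cdot\widehat{\mathbf n}\,p_0\,\mathrm d\Gamma .$$ The minimum power theorem is the assertion that the solution velocity $\mathbf v$ satisfies $\Psi[\mathbf v]\le\Psi[\widetilde{\mathbf v}]$ for all $\widetilde{\mathbf v}\in\mathcal K$. Using the Lagrange multiplier method, with the pressure $p$ serving as the multiplier enforcing incompressibility, one considers the equivalent problem of extremizing over $\mathbf v\in\mathcal V$ and $p$ the functional $$\widehat\Psi[\mathbf v,p]:=\Psi[\mathbf v]-\int_\Omega p\,\mathrm{div}[\mathbf v]\,\mathrm d\Omega .$$ Its first variation is $$\delta\widehat\Psi[\mathbf v,p]\cdot(\delta\mathbf v,\delta p):=\left[\frac{d}{d\epsilon}\widehat\Psi[\mathbf v+\epsilon\,\delta\mathbf v,\,p+\epsilon\,\delta p]\right]_{\epsilon=0},$$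 where the dependence of $\alpha$ on $\mathbf v$ and $p$ is also varied. The necessary condition for the solution fields to satisfy the minimum power theorem is taken to be $\delta\widehat\Psi[\mathbf v,p]\cdot(\delta\mathbf v,\delta p)=0$ for all $\delta\mathbf v\in\mathcal V_0$ and all $\delta p$.
   Formalization: The vanishing of ∂α/∂v and ∂α/∂p is concluded only where v(x) ≠ 0; independence of α is drawn from all solutions; models fail at solutions v ≢ 0; the minimum power inequality also varies the pressure in α (needed for Barus) and is refuted for Darcy-Forchheimer in dimension ≥ 2. *)

theory Defs
  imports "HOL-Analysis.Analysis"
begin

section \<open>Hausdorff measure and surface measure\<close>

definition hausdorff_weight :: "nat \<Rightarrow> 'a::metric_space set \<Rightarrow> ennreal" where
  "hausdorff_weight m U =
     (if U = {} then 0 else ennreal (unit_ball_vol (real m) * (diameter U / 2) ^ m))"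

definition hausdorff_cover :: "real \<Rightarrow> 'a::metric_space set \<Rightarrow> (nat \<Rightarrow> 'a set) set" where
  "hausdorff_cover d A = {U. A \<subseteq> (\<Union>i. U i) \<and> (\<forall>i. bounded (U i) \<and> diameter (U i) \<le> d)}"

definition hausdorff_outer :: "nat \<Rightarrow> 'a::metric_space set \<Rightarrow> ennreal" where
  "hausdorff_outer m A =
     (SUP d\<in>{0<..}. INF U\<in>hausdorff_cover d A. \<Sum>i. hausdorff_weight m (U i))"

definition hausdorff_measure :: "nat \<Rightarrow> 'a::metric_space measure" where
  "hausdorff_measure m = measure_of UNIV (sets borel) (hausdorff_outer m)"

abbreviation surface_measure :: "(real ^ 'n) measure" where
  "surface_measure \<equiv> hausdorff_measure (CARD('n) - 1)"

text \<open>The measure is defined through \<open>measure_of\<close>, which would yield the null measure if the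
  outer measure failed to be countably additive on Borel sets. The lemmas
  \<open>sets_hausdorff_measure\<close> and \<open>emeasure_hausdorff_measure\<close> below (by Caratheodory's criterion
  for metric outer measures) show that this does not happen.\<close>

lemma hausdorff_cover_mono: "A \<subseteq> B \<Longrightarrow> hausdorff_cover d B \<subseteq> hausdorff_cover d A"
  and hausdorff_cover_mono2: "d \<le> e \<Longrightarrow> hausdorff_cover d A \<subseteq> hausdorff_cover e A"
  unfolding hausdorff_cover_def by (blast intro: order_trans)+

lemma hausdorff_outer_mono: "A \<subseteq> B \<Longrightarrow> hausdorff_outer m A \<le> hausdorff_outer m B"
  unfolding hausdorff_outer_def
  by (intro SUP_mono' INF_superset_mono hausdorff_cover_mono order_refl)

lemma hausdorff_outer_empty: "hausdorff_outer m ({} :: 'a::metric_space set) = 0"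
proof -
  have "(INF U\<in>hausdorff_cover d ({} :: 'a set). \<Sum>i. hausdorff_weight m (U i)) = 0" if "d > 0" for d
  proof -
    have "(\<lambda>_. {}) \<in> hausdorff_cover d ({} :: 'a set)"
      using that by (auto simp: hausdorff_cover_def diameter_def)
    then have "(INF U\<in>hausdorff_cover d ({} :: 'a set). \<Sum>i. hausdorff_weight m (U i))
        \<le> (\<Sum>i. hausdorff_weight m ({} :: 'a set))"
      by (rule INF_lower2) simp
    then show ?thesis by (simp add: hausdorff_weight_def)
  qed
  then show ?thesis
    unfolding hausdorff_outer_def by simp
qed

lemma hausdorff_content_subadditive:
  fixes A :: "nat \<Rightarrow> 'a::metric_space set"
  shows "(INF U\<in>hausdorff_cover d (\<Union>i. A i). \<Sum>i. hausdorff_weight m (U i))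
     \<le> (\<Sum>n. INF U\<in>hausdorff_cover d (A n). \<Sum>i. hausdorff_weight m (U i))"
    (is "?O (\<Union>i. A i) \<le> (\<Sum>n. ?O (A n))")
proof (rule ennreal_le_epsilon)
  fix b and e :: real assume "0 < e" "(\<Sum>n. ?O (A n)) < top"
  then have *: "?O (A n) < ?O (A n) + ennreal (e * (1/2)^Suc n)" for n
  proof -
    have less: "x < x + ennreal c" if "x < top" "0 < c" for x c
      using that by (cases x) (auto simp: ennreal_less_iff simp flip: ennreal_plus)
    have "?O (A n) < top"
      using \<open>(\<Sum>n. ?O (A n)) < top\<close> by (rule ennreal_suminf_lessD)
    then show ?thesis using \<open>0 < e\<close> by (intro less) simp_all
  qed
  obtain B where B: "\<And>n. B n \<in> hausdorff_cover d (A n)"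
      "\<And>n. (\<Sum>i. hausdorff_weight m (B n i)) \<le> ?O (A n) + ennreal (e * (1/2)^Suc n)"
    using *[unfolded INF_less_iff] by (metis less_imp_le)
  define C where "C = (\<lambda>(n, i). B n i) \<circ> prod_decode"
  have Bc: "A n \<subseteq> (\<Union>i. B n i)" "bounded (B n i)" "diameter (B n i) \<le> d" for n i
    using B(1)[of n] by (auto simp: hausdorff_cover_def)
  have "(\<Union>n. A n) \<subseteq> (\<Union>i. C i)"
  proof (safe)
    fix x n assume "x \<in> A n"
    then obtain i where "x \<in> B n i" using Bc(1) by blast
    then have "x \<in> C (prod_encode (n, i))" by (simp add: C_def)
    then show "x \<in> (\<Union>i. C i)" by blast
  qed
  then have "C \<in> hausdorff_cover d (\<Union>n. A n)"
    using Bc(2,3) by (auto simp: hausdorff_cover_def C_def split: prod.split)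
  then have "?O (\<Union>i. A i) \<le> (\<Sum>i. hausdorff_weight m (C i))"
    by (rule INF_lower)
  also have "\<dots> = (\<Sum>n. \<Sum>i. hausdorff_weight m (B n i))"
  proof -
    have "(\<Sum>i. ((\<lambda>(n, i). hausdorff_weight m (B n i)) \<circ> prod_decode) i) =
        (\<Sum>n. \<Sum>i. hausdorff_weight m (B n i))"
      unfolding comp_def by (rule suminf_ennreal_2dimen) simp
    moreover have "((\<lambda>(n, i). hausdorff_weight m (B n i)) \<circ> prod_decode) i = hausdorff_weight m (C i)" for i
      by (simp add: C_def split: prod.split)
    ultimately show ?thesis by simp
  qed
  also have "\<dots> \<le> (\<Sum>n. ?O (A n) + ennreal (e * (1/2)^Suc n))"
    using B(2) by (intro suminf_le) auto
  also have "\<dots> = (\<Sum>n. ?O (A n)) + (\<Sum>n. ennreal e * ennreal ((1/2)^Suc n))"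
  proof -
    have "ennreal (e * (1/2)^Suc n) = ennreal e * ennreal ((1/2)^Suc n)" for n
      using \<open>0 < e\<close> by (intro ennreal_mult) auto
    then show ?thesis
      by (simp only: suminf_add[OF summableI summableI, symmetric])
  qed
  also have "\<dots> = (\<Sum>n. ?O (A n)) + ennreal e"
    unfolding ennreal_suminf_cmult
    by (subst suminf_ennreal_eq[OF zero_le_power power_half_series]) auto
  finally show "?O (\<Union>i. A i) \<le> (\<Sum>n. ?O (A n)) + ennreal e" .
qed

lemma hausdorff_outer_subadditive:
  "hausdorff_outer m (\<Union>i. A i) \<le> (\<Sum>n. hausdorff_outer m (A n))"
proof -
  have "(INF U\<in>hausdorff_cover d (\<Union>i. A i). \<Sum>i. hausdorff_weight m (U i))
      \<le> (\<Sum>n. hausdorff_outer m (A n))" if "d > 0" for d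
    using that
    by (intro order_trans[OF hausdorff_content_subadditive] suminf_le)
       (auto simp: hausdorff_outer_def intro!: SUP_upper)
  then show ?thesis
    unfolding hausdorff_outer_def[of m "\<Union>i. A i"] by (intro SUP_least) auto
qed

lemma hausdorff_outer_subadditive2:
  "hausdorff_outer m (A \<union> B) \<le> hausdorff_outer m A + hausdorff_outer m B"
proof -
  have "hausdorff_outer m (\<Union>i. binaryset A B i) \<le> (\<Sum>n. hausdorff_outer m (binaryset A B n))"
    by (rule hausdorff_outer_subadditive)
  also have "(\<Sum>n. hausdorff_outer m (binaryset A B n)) = hausdorff_outer m A + hausdorff_outer m B"
    by (rule suminf_binaryset_eq) (rule hausdorff_outer_empty)
  finally show ?thesis by (simp add: UN_binaryset_eq)
qed

lemma hausdorff_outer_separated: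
  assumes e: "e > 0" and sep: "\<And>x y. x \<in> A \<Longrightarrow> y \<in> B \<Longrightarrow> e \<le> dist x y"
  shows "hausdorff_outer m A + hausdorff_outer m B \<le> hausdorff_outer m (A \<union> B)"
proof -
  define O' where "O' d E = (INF U\<in>hausdorff_cover d E. \<Sum>i. hausdorff_weight m (U i))" for d and E :: "'a set"
  have O: "hausdorff_outer m E = (SUP d\<in>{0<..}. O' d E)" for E :: "'a set"
    by (simp add: hausdorff_outer_def O'_def)
  have mono: "O' b E \<le> O' a E" if "a \<le> b" for a b and E :: "'a set"
    unfolding O'_def using hausdorff_cover_mono2[OF that] by (intro INF_superset_mono) auto
  have small: "O' d A + O' d B \<le> O' d (A \<union> B)" if d: "0 < d" "d < e" for d
    unfolding O'_def[of d "A \<union> B"]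
  proof (rule INF_greatest)
    fix U assume U: "U \<in> hausdorff_cover d (A \<union> B)"
    define UA where "UA i = (if U i \<inter> A = {} then {} else U i)" for i
    define UB where "UB i = (if U i \<inter> B = {} then {} else U i)" for i
    have Ub: "bounded (U i)" "diameter (U i) \<le> d" for i using U by (auto simp: hausdorff_cover_def)
    have Uc: "A \<union> B \<subseteq> (\<Union>i. U i)" using U by (auto simp: hausdorff_cover_def)
    have "A \<subseteq> (\<Union>i. UA i)" "B \<subseteq> (\<Union>i. UB i)"
      using Uc by (fastforce simp: UA_def UB_def)+
    then have "UA \<in> hausdorff_cover d A" "UB \<in> hausdorff_cover d B"
      using Ub d by (auto simp: hausdorff_cover_def UA_def UB_def diameter_def[of "{}"])
    then have "O' d A + O' d B \<le> (\<Sum>i. hausdorff_weight m (UA i)) + (\<Sum>i. hausdorff_weight m (UB i))"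
      unfolding O'_def by (intro add_mono INF_lower)
    also have "\<dots> = (\<Sum>i. hausdorff_weight m (UA i) + hausdorff_weight m (UB i))"
      by (intro suminf_add) auto
    also have "\<dots> \<le> (\<Sum>i. hausdorff_weight m (U i))"
    proof (intro suminf_le)
      fix i
      have "U i \<inter> A = {} \<or> U i \<inter> B = {}"
      proof (rule ccontr)
        assume "\<not> ?thesis"
        then obtain x y where "x \<in> U i" "x \<in> A" "y \<in> U i" "y \<in> B" by blast
        then show False
          using sep[of x y] diameter_bounded_bound[OF Ub(1), of x i y] Ub(2)[of i] d by auto
      qed
      then show "hausdorff_weight m (UA i) + hausdorff_weight m (UB i) \<le> hausdorff_weight m (U i)"
        by (auto simp: UA_def UB_def hausdorff_weight_def)
    qed auto
    finally show "O' d A + O' d B \<le> (\<Sum>i. hausdorff_weight m (U i))" .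
  qed
  have key: "O' a A + O' b B \<le> hausdorff_outer m (A \<union> B)" if "a > 0" "b > 0" for a b
  proof -
    define d where "d = min (min a b) (e/2)"
    have d: "0 < d" "d < e" "d \<le> a" "d \<le> b" using that e by (auto simp: d_def)
    have "O' a A + O' b B \<le> O' d A + O' d B" by (intro add_mono mono d)
    also have "\<dots> \<le> O' d (A \<union> B)" by (rule small) fact+
    also have "\<dots> \<le> hausdorff_outer m (A \<union> B)" unfolding O using d by (intro SUP_upper) auto
    finally show ?thesis .
  qed
  have "hausdorff_outer m A + O' b B \<le> hausdorff_outer m (A \<union> B)" if "b > 0" for b
    unfolding O[of A] using key that
    by (subst ennreal_SUP_add_left[symmetric]) (auto intro!: SUP_least)
  then show ?thesis
    unfolding O[of B]
    by (subst ennreal_SUP_add_right) (auto intro!: SUP_least)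
qed

lemma hausdorff_outer_closed:
  fixes F :: "'a::metric_space set"
  assumes F: "closed F"
  shows "hausdorff_outer m (E \<inter> F) + hausdorff_outer m (E - F) \<le> hausdorff_outer m E"
proof (cases "F = {} \<or> hausdorff_outer m E = top")
  case True
  then show ?thesis by (auto simp: hausdorff_outer_empty)
next
  case False
  then have ne: "F \<noteq> {}" and fin: "hausdorff_outer m E \<noteq> top" by auto
  let ?H = "hausdorff_outer m"
  define S where "S k = {x\<in>E. infdist x F \<ge> 1 / real (Suc k)}" for k
  define D where "D k = S (Suc k) - S k" for k
  have SE: "S k \<subseteq> E" for k by (auto simp: S_def)
  have Smono: "S j \<subseteq> S k" if "j \<le> k" for j k
  proof
    fix x assume "x \<in> S j"
    moreover have "1 / real (Suc k) \<le> 1 / real (Suc j)" using that by (simp add: field_simps)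
    ultimately show "x \<in> S k" by (auto simp: S_def)
  qed
  have main: "?H (E \<inter> F) + ?H (S k) \<le> ?H E" for k
  proof -
    have "?H (E \<inter> F) + ?H (S k) \<le> ?H ((E \<inter> F) \<union> S k)"
    proof (rule hausdorff_outer_separated[of "1 / real (Suc k)"])
      fix x y assume "x \<in> E \<inter> F" "y \<in> S k"
      then show "1 / real (Suc k) \<le> dist x y"
        using infdist_le[of x F y] by (auto simp: S_def dist_commute)
    qed auto
    also have "\<dots> \<le> ?H E" using SE by (intro hausdorff_outer_mono) auto
    finally show ?thesis .
  qed
  have DS: "D k \<subseteq> S (Suc k)" for k by (auto simp: D_def)
  have step: "?H (D (Suc k)) + ?H X \<le> ?H (D (Suc k) \<union> X)" if X: "X \<subseteq> S k" for k X
  proof (rule hausdorff_outer_separated[of "1 / real (Suc k) - 1 / real (Suc (Suc k))"])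
    show "0 < 1 / real (Suc k) - 1 / real (Suc (Suc k))"
      using frac_less2[of 1 1 "real (Suc k)" "real (Suc (Suc k))"] by simp
    fix x y assume x: "x \<in> D (Suc k)" and "y \<in> X"
    then have "1 / real (Suc k) \<le> infdist y F" "infdist x F < 1 / real (Suc (Suc k))"
      using X by (auto simp: S_def D_def)
    moreover have "infdist y F \<le> infdist x F + dist y x" by (rule infdist_triangle)
    ultimately show "1 / real (Suc k) - 1 / real (Suc (Suc k)) \<le> dist x y"
      by (simp add: dist_commute)
  qed
  have sums: "(\<Sum>k<j. ?H (D (2 * k + r))) \<le> ?H (\<Union>k<j. D (2 * k + r))" for j r
  proof (induction j)
    case 0 then show ?case by (simp add: hausdorff_outer_empty)
  next
    case (Suc j)
    show ?case
    proof (cases j)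
      case 0 then show ?thesis by (simp add: lessThan_Suc)
    next
      case (Suc i)
      have sub: "(\<Union>k<j. D (2 * k + r)) \<subseteq> S (2 * i + 1 + r)"
      proof (rule UN_least)
        fix k assume "k \<in> {..<j}"
        then have "Suc (2 * k + r) \<le> 2 * i + 1 + r" using Suc by simp
        then show "D (2 * k + r) \<subseteq> S (2 * i + 1 + r)" using DS Smono by blast
      qed
      have "(\<Sum>k<Suc j. ?H (D (2 * k + r))) \<le> ?H (D (2 * j + r)) + ?H (\<Union>k<j. D (2 * k + r))"
        using Suc.IH by (simp add: add.commute add_mono)
      also have "\<dots> \<le> ?H (D (2 * j + r) \<union> (\<Union>k<j. D (2 * k + r)))"
        using step[OF sub] Suc by simp
      also have "D (2 * j + r) \<union> (\<Union>k<j. D (2 * k + r)) = (\<Union>k<Suc j. D (2 * k + r))"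
        by (simp add: lessThan_Suc)
      finally show ?thesis .
    qed
  qed
  have sumsE: "(\<Sum>k. ?H (D (2 * k + r))) \<le> ?H E" for r
  proof (rule suminf_le_const)
    fix j
    have "(\<Sum>k<j. ?H (D (2 * k + r))) \<le> ?H (\<Union>k<j. D (2 * k + r))" by (rule sums)
    also have "\<dots> \<le> ?H E" using SE by (intro hausdorff_outer_mono) (auto simp: D_def)
    finally show "(\<Sum>k<j. ?H (D (2 * k + r))) \<le> ?H E" .
  qed auto
  have "(\<Sum>k. ?H (D k)) \<le> ?H E + ?H E"
  proof (rule suminf_le_const)
    fix j
    have "(\<Sum>k<j. ?H (D k)) \<le> (\<Sum>k<2 * j. ?H (D k))" by (intro sum_mono2) auto
    also have "\<dots> = (\<Sum>k<j. ?H (D (2 * k + 0))) + (\<Sum>k<j. ?H (D (2 * k + 1)))"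
      by (induction j) (auto simp: algebra_simps)
    also have "\<dots> \<le> (\<Sum>k. ?H (D (2 * k + 0))) + (\<Sum>k. ?H (D (2 * k + 1)))"
      by (intro add_mono sum_le_suminf) auto
    also have "\<dots> \<le> ?H E + ?H E" by (intro add_mono sumsE)
    finally show "(\<Sum>k<j. ?H (D k)) \<le> ?H E + ?H E" .
  qed auto
  then have finD: "(\<Sum>k. ?H (D k)) \<noteq> top" using fin by (auto simp: top_unique)
  have tail: "(\<lambda>j. \<Sum>k. ?H (D (k + j))) \<longlonglongrightarrow> 0"
  proof -
    define h where "h k = enn2real (?H (D k))" for k
    have Hh: "?H (D k) = ennreal (h k)" for k
    proof -
      have "?H (D k) < top" using finD by (intro ennreal_suminf_lessD[of "\<lambda>k. ?H (D k)"]) (simp add: less_top)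
      then show ?thesis by (simp add: h_def)
    qed
    have h0: "0 \<le> h k" for k by (simp add: h_def)
    have "summable h" using finD h0 by (intro summable_suminf_not_top) (auto simp: Hh)
    then have "(\<lambda>j. ennreal (\<Sum>k. h (k + j))) \<longlonglongrightarrow> ennreal 0"
      using suminf_exist_split2[of h] by (intro tendsto_ennrealI) simp
    moreover have "ennreal (\<Sum>k. h (k + j)) = (\<Sum>k. ?H (D (k + j)))" for j
      using \<open>summable h\<close> h0 by (subst suminf_ennreal2[symmetric]) (auto simp: Hh)
    ultimately show ?thesis by simp
  qed
  have cover: "E - F \<subseteq> S j \<union> (\<Union>k. D (k + j))" for j
  proof
    fix x assume x: "x \<in> E - F"
    then have "infdist x F > 0"
      using in_closed_iff_infdist_zero[OF F ne] infdist_nonneg[of x F] by force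
    then obtain i where "inverse (real (Suc i)) < infdist x F" using reals_Archimedean by blast
    then have xi: "\<exists>i. x \<in> S i" using x by (intro exI[of _ i]) (auto simp: S_def inverse_eq_divide)
    define l where "l = (LEAST i. x \<in> S i)"
    have l: "x \<in> S l" unfolding l_def using xi by (rule LeastI_ex)
    show "x \<in> S j \<union> (\<Union>k. D (k + j))"
    proof (cases "l \<le> j")
      case True then show ?thesis using l Smono by blast
    next
      case False
      then obtain i where i: "l = Suc i" "j \<le> i" by (cases l) auto
      then have "x \<notin> S i" using not_less_Least[of i "\<lambda>i. x \<in> S i"] by (auto simp: l_def)
      then have "x \<in> D ((i - j) + j)" using l i by (auto simp: D_def)
      then show ?thesis by blast
    qed
  qed
  have bound: "?H (E \<inter> F) + ?H (E - F) \<le> ?H E + (\<Sum>k. ?H (D (k + j)))" for j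
  proof -
    have "?H (E - F) \<le> ?H (S j \<union> (\<Union>k. D (k + j)))" by (intro hausdorff_outer_mono cover)
    also have "\<dots> \<le> ?H (S j) + ?H (\<Union>k. D (k + j))" by (rule hausdorff_outer_subadditive2)
    also have "\<dots> \<le> ?H (S j) + (\<Sum>k. ?H (D (k + j)))"
      by (intro add_left_mono hausdorff_outer_subadditive)
    finally have "?H (E \<inter> F) + ?H (E - F) \<le> ?H (E \<inter> F) + (?H (S j) + (\<Sum>k. ?H (D (k + j))))"
      by (rule add_left_mono)
    also have "\<dots> \<le> ?H E + (\<Sum>k. ?H (D (k + j)))"
      unfolding add.assoc[symmetric] by (intro add_right_mono main)
    finally show ?thesis .
  qed
  have "(\<lambda>j. ?H E + (\<Sum>k. ?H (D (k + j)))) \<longlonglongrightarrow> ?H E + 0"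
    by (intro tendsto_add tendsto_const tail)
  then show ?thesis using bound by (intro LIMSEQ_le_const[of _ "?H E"]) auto
qed

lemma measure_space_hausdorff_outer: "measure_space UNIV (sets borel) (hausdorff_outer m :: 'a::metric_space set \<Rightarrow> ennreal)"
proof -
  have oms: "outer_measure_space (Pow UNIV) (hausdorff_outer m :: 'a set \<Rightarrow> ennreal)"
    unfolding outer_measure_space_def positive_def increasing_def countably_subadditive_def
    by (auto simp: hausdorff_outer_empty intro: hausdorff_outer_mono hausdorff_outer_subadditive)
  interpret P: sigma_algebra UNIV "Pow UNIV" by (rule sigma_algebra_Pow)
  let ?L = "lambda_system UNIV (Pow UNIV) (hausdorff_outer m :: 'a set \<Rightarrow> ennreal)"
  have ms: "measure_space UNIV ?L (hausdorff_outer m)" by (rule P.caratheodory_lemma[OF oms])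
  interpret L: sigma_algebra UNIV ?L using ms unfolding measure_space_def by blast
  have "F \<in> ?L" if "closed F" for F :: "'a set"
  proof -
    have "hausdorff_outer m (E \<inter> F) + hausdorff_outer m (E - F) = hausdorff_outer m E" for E
      using hausdorff_outer_closed[OF that, of m E] hausdorff_outer_subadditive2[of m "E \<inter> F" "E - F"]
      by (intro antisym) (auto simp: Int_Diff_Un)
    then show ?thesis unfolding P.lambda_system_eq by (simp add: Int_commute)
  qed
  then have "sigma_sets UNIV (Collect closed) \<subseteq> ?L"
    by (intro L.sigma_sets_subset) blast
  then have "sets (borel :: 'a measure) \<subseteq> ?L"
    unfolding borel_eq_closed by simp
  then show ?thesis
    using measure_down[OF ms] sets.sigma_algebra_axioms[of borel] by simp
qed

lemma sets_hausdorff_measure: "sets (hausdorff_measure m) = sets borel"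
  using sets.sigma_sets_eq[of borel] by (simp add: hausdorff_measure_def)

lemma emeasure_hausdorff_measure:
  "A \<in> sets borel \<Longrightarrow> emeasure (hausdorff_measure m) A = hausdorff_outer m A"
  using measure_space_hausdorff_outer[of m]
  by (intro emeasure_measure_of[OF hausdorff_measure_def])
     (auto simp: measure_space_def sets_hausdorff_measure)

section \<open>Fields and domains\<close>

definition C1_on_closure ::
    "(real ^ 'n) set \<Rightarrow> (real ^ 'n \<Rightarrow> 'b::real_normed_vector) \<Rightarrow> bool" where
  "C1_on_closure \<Omega> f \<longleftrightarrow> continuous_on (closure \<Omega>) f \<and>
     (\<exists>D :: real ^ 'n \<Rightarrow> (real ^ 'n) \<Rightarrow>\<^sub>L 'b. continuous_on (closure \<Omega>) D \<and>
        (\<forall>x\<in>\<Omega>. (f has_derivative blinfun_apply (D x)) (at x)))"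

definition divergence :: "(real ^ 'n \<Rightarrow> real ^ 'n) \<Rightarrow> real ^ 'n \<Rightarrow> real" where
  "divergence w x = trace (jacobian w (at x))"

definition gradient :: "(real ^ 'n \<Rightarrow> real) \<Rightarrow> real ^ 'n \<Rightarrow> real ^ 'n" where
  "gradient q x = (\<chi> i. frechet_derivative q (at x) (axis i 1))"

text \<open>Near the boundary point \<open>x\<close> the set is tangent to the half-space with outer normal \<open>\<nu>\<close>:
  every closed cone strictly inside (outside) the half-space lies locally inside (outside) it.\<close>

definition outward_unit_normal :: "(real ^ 'n) set \<Rightarrow> real ^ 'n \<Rightarrow> real ^ 'n \<Rightarrow> bool" where
  "outward_unit_normal \<Omega> x \<nu> \<longleftrightarrow> norm \<nu> = 1 \<and>
     (\<forall>e>0. \<exists>r>0. \<forall>y\<in>ball x r.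
        ((y - x) \<bullet> \<nu> < - e * norm (y - x) \<longrightarrow> y \<in> \<Omega>) \<and>
        ((y - x) \<bullet> \<nu> > e * norm (y - x) \<longrightarrow> y \<notin> closure \<Omega>))"

text \<open>A bounded domain with boundary of finite area that is regular enough to have an outward
  unit normal \<open>n\<close> almost everywhere and to satisfy the classical divergence theorem. Bounded
  Lipschitz domains are examples; as these may have edges and corners, all conditions involving
  the normal are imposed almost everywhere with respect to surface measure.\<close>

definition regular_domain :: "(real ^ 'n) set \<Rightarrow> (real ^ 'n \<Rightarrow> real ^ 'n) \<Rightarrow> bool" where
  "regular_domain \<Omega> n \<longleftrightarrow>
     open \<Omega> \<and> connected \<Omega> \<and> bounded \<Omega> \<and> \<Omega> \<noteq> {} \<and>
     emeasure surface_measure (frontier \<Omega>) < \<infinity> \<and>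
     n \<in> borel_measurable borel \<and>
     (AE x in surface_measure. x \<in> frontier \<Omega> \<longrightarrow> outward_unit_normal \<Omega> x (n x)) \<and>
     (\<forall>w. C1_on_closure \<Omega> w \<longrightarrow>
        (LINT x:\<Omega>|lborel. divergence w x) = (LINT x:frontier \<Omega>|surface_measure. w x \<bullet> n x))"

definition boundary_partition ::
    "(real ^ 'n) set \<Rightarrow> (real ^ 'n) set \<Rightarrow> (real ^ 'n) set \<Rightarrow> bool" where
  "boundary_partition \<Omega> \<Gamma>v \<Gamma>p \<longleftrightarrow>
     \<Gamma>v \<in> sets borel \<and> \<Gamma>p \<in> sets borel \<and> \<Gamma>v \<union> \<Gamma>p = frontier \<Omega> \<and> \<Gamma>v \<inter> \<Gamma>p = {}"

section \<open>Drag functions\<close>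

text \<open>A drag function \<open>\<alpha> x v p\<close> is a function of position, velocity and pressure.
  Differentiability in \<open>(v, p)\<close> is not required at \<open>v = 0\<close>, since the Euclidean norm occurring in
  the Darcy-Forchheimer model is not differentiable there. The last condition holds automatically
  if the derivative extends continuously to \<open>v = 0\<close>.\<close>

definition regular_drag ::
    "(real ^ 'n) set \<Rightarrow> (real ^ 'n \<Rightarrow> real ^ 'n \<Rightarrow> real \<Rightarrow> real) \<Rightarrow> bool" where
  "regular_drag \<Omega> \<alpha> \<longleftrightarrow>
     continuous_on (closure \<Omega> \<times> UNIV) (\<lambda>(x, v, p). \<alpha> x v p) \<and>
     (\<exists>A :: (real ^ 'n) \<times> (real ^ 'n) \<times> real \<Rightarrow> ((real ^ 'n) \<times> real) \<Rightarrow>\<^sub>L real.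
        (\<forall>x\<in>closure \<Omega>. \<forall>v p. v \<noteq> 0 \<longrightarrow>
           ((\<lambda>(w, q). \<alpha> x w q) has_derivative blinfun_apply (A (x, v, p))) (at (v, p))) \<and>
        continuous_on (closure \<Omega> \<times> (- {0}) \<times> UNIV) A \<and>
        (\<forall>S. bounded S \<longrightarrow> bounded (A ` (S \<inter> (closure \<Omega> \<times> (- {0}) \<times> UNIV)))))"

definition drag_dv ::
    "(real ^ 'n \<Rightarrow> real ^ 'n \<Rightarrow> real \<Rightarrow> real) \<Rightarrow> real ^ 'n \<Rightarrow> real ^ 'n \<Rightarrow> real \<Rightarrow> real ^ 'n" where
  "drag_dv \<alpha> x v p = gradient (\<lambda>w. \<alpha> x w p) v"

definition drag_dp ::
    "(real ^ 'n \<Rightarrow> real ^ 'n \<Rightarrow> real \<Rightarrow> real) \<Rightarrow> real ^ 'n \<Rightarrow> real ^ 'n \<Rightarrow> real \<Rightarrow> real" where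
  "drag_dp \<alpha> x v p = deriv (\<lambda>q. \<alpha> x v q) p"

definition barus ::
    "real \<Rightarrow> real \<Rightarrow> (real ^ 'n \<Rightarrow> real) \<Rightarrow> real ^ 'n \<Rightarrow> real ^ 'n \<Rightarrow> real \<Rightarrow> real" where
  "barus \<mu>\<^sub>0 \<beta> k x v p = \<mu>\<^sub>0 / k x * exp (\<beta> * p)"

definition darcy_forchheimer ::
    "real \<Rightarrow> real \<Rightarrow> (real ^ 'n \<Rightarrow> real) \<Rightarrow> real ^ 'n \<Rightarrow> real ^ 'n \<Rightarrow> real \<Rightarrow> real" where
  "darcy_forchheimer \<mu> \<beta> k x v p = \<mu> / k x * (1 + \<beta> * norm v)"

section \<open>Flow equations and the power functional\<close>

definition velocity_space ::
    "(real ^ 'n) set \<Rightarrow> (real ^ 'n \<Rightarrow> real ^ 'n) \<Rightarrow> (real ^ 'n) set \<Rightarrow> (real ^ 'n \<Rightarrow> real) \<Rightarrow>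
     (real ^ 'n \<Rightarrow> real ^ 'n) set" where
  "velocity_space \<Omega> n \<Gamma>v vn =
     {w. C1_on_closure \<Omega> w \<and> (AE x in surface_measure. x \<in> \<Gamma>v \<longrightarrow> w x \<bullet> n x = vn x)}"

definition velocity_variations ::
    "(real ^ 'n) set \<Rightarrow> (real ^ 'n \<Rightarrow> real ^ 'n) \<Rightarrow> (real ^ 'n) set \<Rightarrow>
     (real ^ 'n \<Rightarrow> real ^ 'n) set" where
  "velocity_variations \<Omega> n \<Gamma>v = velocity_space \<Omega> n \<Gamma>v (\<lambda>_. 0)"

definition pressure_space :: "(real ^ 'n) set \<Rightarrow> (real ^ 'n \<Rightarrow> real) set" where
  "pressure_space \<Omega> = {q. C1_on_closure \<Omega> q}"

definition kinematically_admissible ::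
    "(real ^ 'n) set \<Rightarrow> (real ^ 'n \<Rightarrow> real ^ 'n) \<Rightarrow> (real ^ 'n) set \<Rightarrow> (real ^ 'n \<Rightarrow> real) \<Rightarrow>
     (real ^ 'n \<Rightarrow> real ^ 'n) set" where
  "kinematically_admissible \<Omega> n \<Gamma>v vn =
     {w \<in> velocity_space \<Omega> n \<Gamma>v vn. \<forall>x\<in>\<Omega>. divergence w x = 0}"

definition flow_solution ::
    "(real ^ 'n) set \<Rightarrow> (real ^ 'n \<Rightarrow> real ^ 'n) \<Rightarrow> (real ^ 'n) set \<Rightarrow> (real ^ 'n) set \<Rightarrow>
     real \<Rightarrow> (real ^ 'n \<Rightarrow> real ^ 'n) \<Rightarrow> (real ^ 'n \<Rightarrow> real) \<Rightarrow> (real ^ 'n \<Rightarrow> real) \<Rightarrow>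
     (real ^ 'n \<Rightarrow> real ^ 'n \<Rightarrow> real \<Rightarrow> real) \<Rightarrow>
     (real ^ 'n \<Rightarrow> real ^ 'n) \<Rightarrow> (real ^ 'n \<Rightarrow> real) \<Rightarrow> bool" where
  "flow_solution \<Omega> n \<Gamma>v \<Gamma>p \<rho> b vn p\<^sub>0 \<alpha> v p \<longleftrightarrow>
     C1_on_closure \<Omega> v \<and> C1_on_closure \<Omega> p \<and>
     (\<forall>x\<in>\<Omega>. \<alpha> x (v x) (p x) *\<^sub>R v x + gradient p x = \<rho> *\<^sub>R b x) \<and>
     (\<forall>x\<in>\<Omega>. divergence v x = 0) \<and>
     (AE x in surface_measure. x \<in> \<Gamma>v \<longrightarrow> v x \<bullet> n x = vn x) \<and>
     (\<forall>x\<in>\<Gamma>p. p x = p\<^sub>0 x)"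

text \<open>The power functional depends on a pressure field through the drag coefficient.\<close>

definition power_functional ::
    "(real ^ 'n) set \<Rightarrow> (real ^ 'n \<Rightarrow> real ^ 'n) \<Rightarrow> (real ^ 'n) set \<Rightarrow>
     real \<Rightarrow> (real ^ 'n \<Rightarrow> real ^ 'n) \<Rightarrow> (real ^ 'n \<Rightarrow> real) \<Rightarrow>
     (real ^ 'n \<Rightarrow> real ^ 'n \<Rightarrow> real \<Rightarrow> real) \<Rightarrow>
     (real ^ 'n \<Rightarrow> real ^ 'n) \<Rightarrow> (real ^ 'n \<Rightarrow> real) \<Rightarrow> real" where
  "power_functional \<Omega> n \<Gamma>p \<rho> b p\<^sub>0 \<alpha> w q =
     (LINT x:\<Omega>|lborel. 1/2 * \<alpha> x (w x) (q x) * (w x \<bullet> w x))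
     - (LINT x:\<Omega>|lborel. w x \<bullet> (\<rho> *\<^sub>R b x))
     + (LINT x:\<Gamma>p|surface_measure. (w x \<bullet> n x) * p\<^sub>0 x)"

definition lagrangian ::
    "(real ^ 'n) set \<Rightarrow> (real ^ 'n \<Rightarrow> real ^ 'n) \<Rightarrow> (real ^ 'n) set \<Rightarrow>
     real \<Rightarrow> (real ^ 'n \<Rightarrow> real ^ 'n) \<Rightarrow> (real ^ 'n \<Rightarrow> real) \<Rightarrow>
     (real ^ 'n \<Rightarrow> real ^ 'n \<Rightarrow> real \<Rightarrow> real) \<Rightarrow>
     (real ^ 'n \<Rightarrow> real ^ 'n) \<Rightarrow> (real ^ 'n \<Rightarrow> real) \<Rightarrow> real" where
  "lagrangian \<Omega> n \<Gamma>p \<rho> b p\<^sub>0 \<alpha> w q =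
     power_functional \<Omega> n \<Gamma>p \<rho> b p\<^sub>0 \<alpha> w q - (LINT x:\<Omega>|lborel. q x * divergence w x)"

definition lagrangian_along ::
    "(real ^ 'n) set \<Rightarrow> (real ^ 'n \<Rightarrow> real ^ 'n) \<Rightarrow> (real ^ 'n) set \<Rightarrow>
     real \<Rightarrow> (real ^ 'n \<Rightarrow> real ^ 'n) \<Rightarrow> (real ^ 'n \<Rightarrow> real) \<Rightarrow>
     (real ^ 'n \<Rightarrow> real ^ 'n \<Rightarrow> real \<Rightarrow> real) \<Rightarrow>
     (real ^ 'n \<Rightarrow> real ^ 'n) \<Rightarrow> (real ^ 'n \<Rightarrow> real) \<Rightarrow>
     (real ^ 'n \<Rightarrow> real ^ 'n) \<Rightarrow> (real ^ 'n \<Rightarrow> real) \<Rightarrow> real \<Rightarrow> real" where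
  "lagrangian_along \<Omega> n \<Gamma>p \<rho> b p\<^sub>0 \<alpha> v p \<delta>v \<delta>p \<epsilon> =
     lagrangian \<Omega> n \<Gamma>p \<rho> b p\<^sub>0 \<alpha> (\<lambda>x. v x + \<epsilon> *\<^sub>R \<delta>v x) (\<lambda>x. p x + \<epsilon> * \<delta>p x)"

definition first_variation ::
    "(real ^ 'n) set \<Rightarrow> (real ^ 'n \<Rightarrow> real ^ 'n) \<Rightarrow> (real ^ 'n) set \<Rightarrow>
     real \<Rightarrow> (real ^ 'n \<Rightarrow> real ^ 'n) \<Rightarrow> (real ^ 'n \<Rightarrow> real) \<Rightarrow>
     (real ^ 'n \<Rightarrow> real ^ 'n \<Rightarrow> real \<Rightarrow> real) \<Rightarrow>
     (real ^ 'n \<Rightarrow> real ^ 'n) \<Rightarrow> (real ^ 'n \<Rightarrow> real) \<Rightarrow>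
     (real ^ 'n \<Rightarrow> real ^ 'n) \<Rightarrow> (real ^ 'n \<Rightarrow> real) \<Rightarrow> real" where
  "first_variation \<Omega> n \<Gamma>p \<rho> b p\<^sub>0 \<alpha> v p \<delta>v \<delta>p =
     deriv (lagrangian_along \<Omega> n \<Gamma>p \<rho> b p\<^sub>0 \<alpha> v p \<delta>v \<delta>p) 0"

definition drag_variation_integral ::
    "(real ^ 'n) set \<Rightarrow> (real ^ 'n \<Rightarrow> real ^ 'n \<Rightarrow> real \<Rightarrow> real) \<Rightarrow>
     (real ^ 'n \<Rightarrow> real ^ 'n) \<Rightarrow> (real ^ 'n \<Rightarrow> real) \<Rightarrow>
     (real ^ 'n \<Rightarrow> real ^ 'n) \<Rightarrow> (real ^ 'n \<Rightarrow> real) \<Rightarrow> real" where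
  "drag_variation_integral \<Omega> \<alpha> v p \<delta>v \<delta>p =
     (LINT x:\<Omega>|lborel. 1/2 * (drag_dv \<alpha> x (v x) (p x) \<bullet> \<delta>v x + drag_dp \<alpha> x (v x) (p x) * \<delta>p x)
        * (v x \<bullet> v x))"

definition necessary_condition ::
    "(real ^ 'n) set \<Rightarrow> (real ^ 'n \<Rightarrow> real ^ 'n) \<Rightarrow> (real ^ 'n) set \<Rightarrow> (real ^ 'n) set \<Rightarrow>
     real \<Rightarrow> (real ^ 'n \<Rightarrow> real ^ 'n) \<Rightarrow> (real ^ 'n \<Rightarrow> real) \<Rightarrow>
     (real ^ 'n \<Rightarrow> real ^ 'n \<Rightarrow> real \<Rightarrow> real) \<Rightarrow>
     (real ^ 'n \<Rightarrow> real ^ 'n) \<Rightarrow> (real ^ 'n \<Rightarrow> real) \<Rightarrow> bool" where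
  "necessary_condition \<Omega> n \<Gamma>v \<Gamma>p \<rho> b p\<^sub>0 \<alpha> v p \<longleftrightarrow>
     (\<forall>\<delta>v\<in>velocity_variations \<Omega> n \<Gamma>v. \<forall>\<delta>p\<in>pressure_space \<Omega>.
        first_variation \<Omega> n \<Gamma>p \<rho> b p\<^sub>0 \<alpha> v p \<delta>v \<delta>p = 0)"

text \<open>The minimum power theorem for a given domain, density and drag function, as a statement
  about all data and solutions. Since the pressure is varied as well, the drag of a competitor is
  evaluated at the competing pressure \<open>q\<close>; if the drag does not depend on the pressure, the
  quantifier over \<open>q\<close> is immaterial. With the drag frozen at the solution pressure, every
  pressure-dependent but velocity-independent drag such as that of Barus would count as a Darcy
  drag with modified permeability.\<close>

definition minimum_power_theorem ::
    "(real ^ 'n) set \<Rightarrow> (real ^ 'n \<Rightarrow> real ^ 'n) \<Rightarrow> (real ^ 'n) set \<Rightarrow> (real ^ 'n) set \<Rightarrow>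
     real \<Rightarrow> (real ^ 'n \<Rightarrow> real ^ 'n \<Rightarrow> real \<Rightarrow> real) \<Rightarrow> bool" where
  "minimum_power_theorem \<Omega> n \<Gamma>v \<Gamma>p \<rho> \<alpha> \<longleftrightarrow>
     (\<forall>b vn p\<^sub>0 v p. flow_solution \<Omega> n \<Gamma>v \<Gamma>p \<rho> b vn p\<^sub>0 \<alpha> v p \<longrightarrow>
        (\<forall>w\<in>kinematically_admissible \<Omega> n \<Gamma>v vn. \<forall>q\<in>pressure_space \<Omega>.
           power_functional \<Omega> n \<Gamma>p \<rho> b p\<^sub>0 \<alpha> v p \<le> power_functional \<Omega> n \<Gamma>p \<rho> b p\<^sub>0 \<alpha> w q))"

end

theory Submission
  imports Defs
begin

text \<open>At a solution of the flow equations, all contributions to the first variation of the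
  Lagrangian cancel except for the variation of the drag. Indeed, varying the dissipation
  \<open>\<alpha> |v|\<^sup>2 / 2\<close> gives half the variation of \<open>\<alpha>\<close> times \<open>|v|\<^sup>2\<close>, plus \<open>\<alpha> v \<bullet> \<delta>v\<close>. The flow equation
  turns the second term, together with the body force, into \<open>- \<delta>v \<bullet> grad p\<close>, and the divergence
  theorem for \<open>p \<delta>v\<close> (lemma \<open>pressure_work\<close>) absorbs this into the boundary and constraint terms.
  This is \<open>lagrangian_derivative\<close>. Differentiation under the integral is justified although the
  drag may have a kink at \<open>v = 0\<close>, since the factor \<open>|v|\<^sup>2\<close> smooths it out
  (\<open>dissipation_line_derivative\<close>).

  Testing the remaining integral with bump functions shows that it vanishes for all variations
  exactly if the partial derivatives of the drag vanish wherever the solution velocity does not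
  (\<open>drag_variation_integral_vanishes_iff\<close>). Since all constant fields are solutions for suitable
  data, every value of velocity and pressure can be attained; so the necessary condition holds for
  all data only if the drag is independent of both
  (\<open>necessary_condition_for_all_data_iff\<close>). For the Darcy-Forchheimer drag the derivative in
  \<open>v\<close>, and for the Barus drag the derivative in \<open>p\<close>, never vanishes at \<open>v \<noteq> 0\<close>.

  The minimum power theorem itself is refuted by explicit competitors, for any partition of the
  boundary. For Darcy-Forchheimer, a swirl \<open>\<psi>\<close> that is divergence free and compactly supported in
  the domain is compared with its multiples \<open>t \<psi>\<close>, whose power is a cubic polynomial in \<open>t\<close> with
  nonzero derivative at \<open>t = 1\<close>; such swirls exist from dimension two on. For Barus, a uniform
  flow is compared with itself at a different constant pressure.\<close>

section \<open>Continuously differentiable fields\<close>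

text \<open>In finite dimension, continuity of the derivative in every fixed direction already implies
  continuity in the operator norm.\<close>

lemma C1_on_closureI:
  fixes f :: "real ^ 'n \<Rightarrow> 'b::real_normed_vector"
  assumes "continuous_on (closure \<Omega>) f"
    and lin: "\<And>x. bounded_linear (f' x)"
    and cont: "\<And>h. continuous_on (closure \<Omega>) (\<lambda>x. f' x h)"
    and der: "\<And>x. x \<in> \<Omega> \<Longrightarrow> (f has_derivative f' x) (at x)"
  shows "C1_on_closure \<Omega> f"
  unfolding C1_on_closure_def
proof (intro conjI exI[of _ "\<lambda>x. Blinfun (f' x)"] ballI)
  show "continuous_on (closure \<Omega>) (\<lambda>x. Blinfun (f' x))"
    unfolding continuous_on_def
  proof (intro ballI tendsto_componentwise1)
    fix x h assume "x \<in> closure \<Omega>"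
    then have "((\<lambda>y. f' y h) \<longlongrightarrow> f' x h) (at x within closure \<Omega>)"
      using cont by (auto simp: continuous_on_def)
    then show "((\<lambda>y. blinfun_apply (Blinfun (f' y)) h) \<longlongrightarrow> blinfun_apply (Blinfun (f' x)) h)
        (at x within closure \<Omega>)"
      by (simp add: bounded_linear_Blinfun_apply lin)
  qed
qed (simp_all add: assms bounded_linear_Blinfun_apply)

lemma C1_on_closureE:
  assumes "C1_on_closure \<Omega> f"
  obtains D where "\<And>h. continuous_on (closure \<Omega>) (\<lambda>x. blinfun_apply (D x) h)"
    and "\<And>x. x \<in> \<Omega> \<Longrightarrow> (f has_derivative blinfun_apply (D x)) (at x)"
proof -
  obtain D where D: "continuous_on (closure \<Omega>) D"
      "\<And>x. x \<in> \<Omega> \<Longrightarrow> (f has_derivative blinfun_apply (D x)) (at x)"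
    using assms by (auto simp: C1_on_closure_def)
  show ?thesis
    by (rule that[of D]) (use D in \<open>auto intro!: continuous_intros\<close>)
qed

lemma C1_on_closure_continuous: "C1_on_closure \<Omega> f \<Longrightarrow> continuous_on (closure \<Omega>) f"
  by (simp add: C1_on_closure_def)

lemma C1_on_closure_has_derivative:
  "C1_on_closure \<Omega> f \<Longrightarrow> x \<in> \<Omega> \<Longrightarrow> \<exists>D. (f has_derivative D) (at x)"
  unfolding C1_on_closure_def by (elim conjE exE) (rule exI, erule (1) bspec)

lemma C1_on_closure_const: "C1_on_closure \<Omega> (\<lambda>x. c)"
  by (rule C1_on_closureI[where f' = "\<lambda>x h. 0"]) auto

lemma C1_on_closure_scaleR:
  fixes q :: "real ^ 'n \<Rightarrow> real" and w :: "real ^ 'n \<Rightarrow> 'b::real_normed_vector"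
  assumes q: "C1_on_closure \<Omega> q" and w: "C1_on_closure \<Omega> w"
  shows "C1_on_closure \<Omega> (\<lambda>x. q x *\<^sub>R w x)"
proof -
  obtain D where D: "\<And>h. continuous_on (closure \<Omega>) (\<lambda>x. blinfun_apply (D x) h)"
      "\<And>x. x \<in> \<Omega> \<Longrightarrow> (q has_derivative blinfun_apply (D x)) (at x)"
    using C1_on_closureE[OF q] by metis
  obtain E where E: "\<And>h. continuous_on (closure \<Omega>) (\<lambda>x. blinfun_apply (E x) h)"
      "\<And>x. x \<in> \<Omega> \<Longrightarrow> (w has_derivative blinfun_apply (E x)) (at x)"
    using C1_on_closureE[OF w] by metis
  note cont = C1_on_closure_continuous[OF q] C1_on_closure_continuous[OF w] D(1) E(1)
  show ?thesis
  proof (rule C1_on_closureI[where f' = "\<lambda>x h. q x *\<^sub>R E x h + D x h *\<^sub>R w x"])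
    show "bounded_linear (\<lambda>h. q x *\<^sub>R blinfun_apply (E x) h + blinfun_apply (D x) h *\<^sub>R w x)" for x
      by (intro bounded_linear_intros)
    show "((\<lambda>x. q x *\<^sub>R w x) has_derivative (\<lambda>h. q x *\<^sub>R E x h + D x h *\<^sub>R w x)) (at x)"
      if "x \<in> \<Omega>" for x
      using D(2)[OF that] E(2)[OF that] by (rule has_derivative_scaleR)
  qed (intro continuous_intros cont)+
qed

lemma divergence_has_derivative:
  assumes "(w has_derivative D) (at x)"
  shows "divergence w x = (\<Sum>i\<in>UNIV. D (axis i 1) $ i)"
  using frechet_derivative_at[OF assms]
  by (simp add: divergence_def trace_def jacobian_def matrix_def)

lemma gradient_has_derivative:
  assumes "(q has_derivative D) (at x)"
  shows "gradient q x \<bullet> h = D h"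
proof -
  interpret D: bounded_linear D using assms by (rule has_derivative_bounded_linear)
  have "gradient q x \<bullet> h = (\<Sum>i\<in>UNIV. h $ i * D (axis i 1))"
    using frechet_derivative_at[OF assms]
    by (simp add: gradient_def inner_vec_def mult.commute)
  also have "\<dots> = D (\<Sum>i\<in>UNIV. (h $ i) *\<^sub>R axis i 1)"
    by (simp add: D.sum D.scaleR)
  also have "(\<Sum>i\<in>UNIV. (h $ i) *\<^sub>R axis i 1) = h"
    using basis_expansion[of h] by (simp add: scalar_mult_eq_scaleR)
  finally show ?thesis .
qed

lemma divergence_add_scaleR:
  assumes "(u has_derivative D) (at x)" "(w has_derivative E) (at x)"
  shows "divergence (\<lambda>x. u x + c *\<^sub>R w x) x = divergence u x + c * divergence w x"
proof -
  have "((\<lambda>x. u x + c *\<^sub>R w x) has_derivative (\<lambda>h. D h + c *\<^sub>R E h)) (at x)"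
    using assms by (intro derivative_intros)
  from divergence_has_derivative[OF this] show ?thesis
    by (simp add: divergence_has_derivative[OF assms(1)] divergence_has_derivative[OF assms(2)]
        sum.distrib sum_distrib_left)
qed

lemma divergence_scaleR_field:
  assumes q: "(q has_derivative D) (at x)" and w: "(w has_derivative E) (at x)"
  shows "divergence (\<lambda>x. q x *\<^sub>R w x) x = q x * divergence w x + w x \<bullet> gradient q x"
proof -
  have "gradient q x \<bullet> w x = (\<Sum>i\<in>UNIV. D (axis i 1) * w x $ i)"
    by (simp add: inner_vec_def gradient_def frechet_derivative_at[OF q, symmetric])
  moreover have "((\<lambda>x. q x *\<^sub>R w x) has_derivative (\<lambda>h. q x *\<^sub>R E h + D h *\<^sub>R w x)) (at x)"
    using q w by (rule has_derivative_scaleR)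
  ultimately show ?thesis
    by (simp add: divergence_has_derivative[OF w] divergence_has_derivative
        sum.distrib sum_distrib_left inner_commute)
qed

lemma continuous_on_divergence:
  assumes "C1_on_closure \<Omega> w"
  obtains d where "continuous_on (closure \<Omega>) d" "\<And>x. x \<in> \<Omega> \<Longrightarrow> divergence w x = d x"
proof -
  obtain D where D: "\<And>h. continuous_on (closure \<Omega>) (\<lambda>x. blinfun_apply (D x) h)"
      "\<And>x. x \<in> \<Omega> \<Longrightarrow> (w has_derivative blinfun_apply (D x)) (at x)"
    using C1_on_closureE[OF assms] by metis
  show ?thesis
    by (rule that[of "\<lambda>x. \<Sum>i\<in>UNIV. blinfun_apply (D x) (axis i 1) $ i"])
       (auto intro!: continuous_intros D(1) simp: divergence_has_derivative[OF D(2)])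
qed

lemma continuous_on_gradient:
  assumes "C1_on_closure \<Omega> q"
  obtains g where "continuous_on (closure \<Omega>) g" "\<And>x. x \<in> \<Omega> \<Longrightarrow> gradient q x = g x"
proof -
  obtain D where D: "\<And>h. continuous_on (closure \<Omega>) (\<lambda>x. blinfun_apply (D x) h)"
      "\<And>x. x \<in> \<Omega> \<Longrightarrow> (q has_derivative blinfun_apply (D x)) (at x)"
    using C1_on_closureE[OF assms] by metis
  show ?thesis
    by (rule that[of "\<lambda>x. \<chi> i. blinfun_apply (D x) (axis i 1)"])
       (auto intro!: continuous_intros D(1) simp: gradient_def frechet_derivative_at[OF D(2), symmetric])
qed

section \<open>Integration over the domain\<close>

lemma set_integrable_continuous_on_closure:
  fixes f :: "real ^ 'n \<Rightarrow> real"
  assumes "open \<Omega>" "bounded \<Omega>" "continuous_on (closure \<Omega>) f"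
  shows "set_integrable lborel \<Omega> f"
proof (rule set_integrable_subset)
  show "set_integrable lborel (closure \<Omega>) f"
    unfolding set_integrable_def using assms by (intro borel_integrable_compact) auto
qed (use assms closure_subset in auto)

lemma set_integral_pos:
  fixes f :: "real ^ 'n \<Rightarrow> real"
  assumes int: "set_integrable lborel \<Omega> f"
    and nonneg: "\<And>x. x \<in> \<Omega> \<Longrightarrow> 0 \<le> f x"
    and B: "open B" "B \<noteq> {}" "B \<subseteq> \<Omega>" and pos: "\<And>x. x \<in> B \<Longrightarrow> 0 < f x"
  shows "0 < (LINT x:\<Omega>|lborel. f x)"
proof -
  let ?g = "\<lambda>x. indicator \<Omega> x *\<^sub>R f x"
  have g: "integrable lborel ?g" using int by (simp add: set_integrable_def)
  have g0: "0 \<le> ?g x" for x using nonneg by (auto simp: indicator_def)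
  have "integral\<^sup>L lborel ?g \<noteq> 0"
  proof
    assume "integral\<^sup>L lborel ?g = 0"
    then have "AE x in lborel. ?g x = 0"
      using integral_nonneg_eq_0_iff_AE[OF g] g0 by simp
    then have "AE x in lborel. x \<notin> B"
      by eventually_elim (use B pos in \<open>force simp: indicator_def\<close>)
    then have "emeasure lborel B = 0"
      using B(1) by (subst (asm) AE_iff_measurable[where N = B]) auto
    then have "B \<in> null_sets lebesgue"
      using B(1) by (auto simp: null_sets_def intro!: null_sets_completionI)
    then have "negligible B"
      by (simp add: negligible_iff_null_sets)
    with open_not_negligible[OF B(1,2)] show False by simp
  qed
  moreover have "integral\<^sup>L lborel ?g \<ge> 0" using g0 by (rule Bochner_Integration.integral_nonneg)
  ultimately show ?thesis by (simp add: set_lebesgue_integral_def)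
qed

text \<open>The Lipschitz bound dominates the difference quotients at \<open>0\<close>. The function \<open>F'\<close>
  is measurable as a limit of a sequence of such quotients.\<close>

lemma has_derivative_set_integral_parameter:
  fixes F :: "real \<Rightarrow> 'a \<Rightarrow> real"
  assumes S: "S \<in> sets M" "emeasure M S < \<infinity>"
    and int: "\<And>e. set_integrable M S (F e)"
    and der: "\<And>x. x \<in> S \<Longrightarrow> ((\<lambda>e. F e x) has_real_derivative F' x) (at 0)"
    and lip: "\<And>x e. x \<in> S \<Longrightarrow> \<bar>e\<bar> \<le> 1 \<Longrightarrow> \<bar>F e x - F 0 x\<bar> \<le> C * \<bar>e\<bar>"
  shows "((\<lambda>e. LINT x:S|M. F e x) has_real_derivative (LINT x:S|M. F' x)) (at 0)"
    and "set_integrable M S F'"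
proof -
  define Q where "Q h x = indicator S x *\<^sub>R ((F h x - F 0 x) / h)" for h x
  have Q_int: "integrable M (Q h)" for h
    using set_integrable_divide[OF set_integral_diff(1)[OF int int, of h 0], of h]
    by (simp add: Q_def[abs_def] set_integrable_def)
  have Q_integral: "integral\<^sup>L M (Q h) = ((LINT x:S|M. F h x) - (LINT x:S|M. F 0 x)) / h" for h
  proof -
    have "integral\<^sup>L M (Q h) = (LINT x:S|M. (F h x - F 0 x) / h)"
      by (simp only: Q_def[abs_def] set_lebesgue_integral_def)
    then show ?thesis
      by (simp only: set_integral_divide_zero set_integral_diff(2)[OF int int])
  qed
  have lim: "(\<lambda>k. Q (X k) x) \<longlonglongrightarrow> indicator S x *\<^sub>R F' x"
    if "\<And>k. X k \<noteq> 0" "X \<longlonglongrightarrow> 0" for X x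
  proof (cases "x \<in> S")
    case True
    have "((\<lambda>h. (F h x - F 0 x) / h) \<longlongrightarrow> F' x) (at 0)"
      using der[OF True] by (simp add: has_field_derivative_def DERIV_def
          flip: has_field_derivative_def)
    then show ?thesis
      using that True unfolding tendsto_at_iff_sequentially by (auto simp: Q_def comp_def)
  qed (simp add: Q_def)
  have bound: "norm (Q h x) \<le> indicator S x *\<^sub>R C" if "\<bar>h\<bar> \<le> 1" "h \<noteq> 0" for h x
    using lip[of x h] that by (auto simp: Q_def indicator_def divide_simps)
  have C_int: "integrable M (\<lambda>x. indicator S x *\<^sub>R C)"
    using S by (intro integrable_scaleR_left) auto
  have seq: "1 / real (Suc k) \<noteq> 0" "(\<lambda>k. 1 / real (Suc k)) \<longlonglongrightarrow> 0"
      "\<bar>1 / real (Suc k)\<bar> \<le> 1" for k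
    using LIMSEQ_inverse_real_of_nat by (auto simp: inverse_eq_divide)
  have meas: "(\<lambda>x. indicator S x *\<^sub>R F' x) \<in> borel_measurable M"
    by (rule borel_measurable_LIMSEQ_real[OF lim[OF seq(1,2)]]) (use Q_int in auto)
  show "set_integrable M S F'"
    unfolding set_integrable_def
    by (rule integrable_dominated_convergence[where s = "\<lambda>k. Q (1 / real (Suc k))"
          and w = "\<lambda>x. indicator S x *\<^sub>R C"])
       (use meas C_int Q_int bound seq lim[OF seq(1,2)] in auto)
  have "((\<lambda>h. integral\<^sup>L M (Q h)) \<longlongrightarrow> (LINT x:S|M. F' x)) (at 0)"
    unfolding tendsto_at_iff_sequentially comp_def
  proof safe
    fix X :: "nat \<Rightarrow> real" assume "\<forall>i. X i \<in> UNIV - {0}" and X0: "X \<longlonglongrightarrow> 0"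
    then have X: "\<And>i. X i \<noteq> 0" by auto
    obtain N where N: "\<And>k. k \<ge> N \<Longrightarrow> \<bar>X k\<bar> < 1"
      using LIMSEQ_D[OF X0, of 1] by auto
    have "(\<lambda>k. integral\<^sup>L M (Q (X (k + N)))) \<longlonglongrightarrow> (LINT x:S|M. F' x)"
      unfolding set_lebesgue_integral_def
    proof (rule integral_dominated_convergence[where w = "\<lambda>x. indicator S x *\<^sub>R C"])
      show "AE x in M. (\<lambda>k. Q (X (k + N)) x) \<longlonglongrightarrow> indicator S x *\<^sub>R F' x"
        using X X0 by (intro AE_I2 lim LIMSEQ_ignore_initial_segment)
      show "AE x in M. norm (Q (X (k + N)) x) \<le> indicator S x *\<^sub>R C" for k
        using X N[of "k + N"] by (intro AE_I2 bound) auto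
    qed (use meas C_int Q_int in auto)
    then show "(\<lambda>k. integral\<^sup>L M (Q (X k))) \<longlonglongrightarrow> (LINT x:S|M. F' x)"
      by (rule LIMSEQ_offset)
  qed
  then show "((\<lambda>e. LINT x:S|M. F e x) has_real_derivative (LINT x:S|M. F' x)) (at 0)"
    unfolding DERIV_def Q_integral by simp
qed

section \<open>The first variation\<close>

lemma regular_drag_continuous:
  assumes "regular_drag \<Omega> \<alpha>" "S \<subseteq> closure \<Omega>" "continuous_on S w" "continuous_on S q"
  shows "continuous_on S (\<lambda>x. \<alpha> x (w x) (q x))"
proof -
  have "continuous_on (closure \<Omega> \<times> UNIV) (\<lambda>(x, v, p). \<alpha> x v p)"
    using assms(1) by (simp add: regular_drag_def)
  moreover have "continuous_on S (\<lambda>x. (x, w x, q x))"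
    using assms by (intro continuous_intros)
  ultimately have "continuous_on S (\<lambda>x. (\<lambda>(x, v, p). \<alpha> x v p) (x, w x, q x))"
    by (rule continuous_on_compose2) (use assms in auto)
  then show ?thesis by simp
qed

lemma regular_dragE:
  fixes \<alpha> :: "real ^ 'n \<Rightarrow> real ^ 'n \<Rightarrow> real \<Rightarrow> real"
  assumes "regular_drag \<Omega> \<alpha>"
  obtains A :: "(real ^ 'n) \<times> (real ^ 'n) \<times> real \<Rightarrow> ((real ^ 'n) \<times> real) \<Rightarrow>\<^sub>L real"
    where "\<And>x v p. x \<in> closure \<Omega> \<Longrightarrow> v \<noteq> 0 \<Longrightarrow>
           ((\<lambda>(w, q). \<alpha> x w q) has_derivative blinfun_apply (A (x, v, p))) (at (v, p))"
      "continuous_on (closure \<Omega> \<times> (- {0}) \<times> UNIV) A"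
      "\<And>S. bounded S \<Longrightarrow> bounded (A ` (S \<inter> (closure \<Omega> \<times> (- {0}) \<times> UNIV)))"
proof -
  from assms[unfolded regular_drag_def, THEN conjunct2] obtain A :: "(real ^ 'n) \<times> (real ^ 'n) \<times> real \<Rightarrow> ((real ^ 'n) \<times> real) \<Rightarrow>\<^sub>L real"
    where A: "(\<forall>x\<in>closure \<Omega>. \<forall>v p. v \<noteq> 0 \<longrightarrow>
           ((\<lambda>(w, q). \<alpha> x w q) has_derivative blinfun_apply (A (x, v, p))) (at (v, p))) \<and>
        continuous_on (closure \<Omega> \<times> (- {0}) \<times> UNIV) A \<and>
        (\<forall>S. bounded S \<longrightarrow> bounded (A ` (S \<inter> (closure \<Omega> \<times> (- {0}) \<times> UNIV))))"
    by (rule exE)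
  note A1 = A[THEN conjunct1, rule_format] and A2 = A[THEN conjunct2, THEN conjunct1]
    and A3 = A[THEN conjunct2, THEN conjunct2, rule_format]
  show ?thesis by (rule that[of A]; (rule A1 A2 A3)?; assumption?)
qed

lemma drag_partials:
  assumes "((\<lambda>(w, q). \<alpha> x w q) has_derivative D) (at (v, p))"
  shows "D (h, r) = drag_dv \<alpha> x v p \<bullet> h + drag_dp \<alpha> x v p * r"
proof -
  interpret D: bounded_linear D using assms by (rule has_derivative_bounded_linear)
  have v: "((\<lambda>w. \<alpha> x w p) has_derivative (\<lambda>h. D (h, 0))) (at v)"
  proof -
    have "((\<lambda>w. (w, p)) has_derivative (\<lambda>h. (h, 0))) (at v)"
      by (intro derivative_eq_intros) auto
    from has_derivative_compose[OF this assms] show ?thesis by simp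
  qed
  have p: "((\<lambda>q. \<alpha> x v q) has_derivative (\<lambda>r. D (0, r))) (at p)"
  proof -
    have "((\<lambda>q. (v, q)) has_derivative (\<lambda>r. (0, r))) (at p)"
      by (intro derivative_eq_intros) auto
    from has_derivative_compose[OF this assms] show ?thesis by simp
  qed
  have D0: "D (0, r) = D (0, 1) * r" for r using D.scaleR[of r "(0, 1)"] by (simp add: mult.commute)
  have "((\<lambda>q. \<alpha> x v q) has_real_derivative D (0, 1)) (at p)"
  proof -
    have "(\<lambda>r. D (0, r)) = (*) (D (0, 1))" by (rule ext) (rule D0)
    then show ?thesis using p by (simp only: has_field_derivative_def)
  qed
  then have "drag_dp \<alpha> x v p = D (0, 1)"
    unfolding drag_dp_def by (rule DERIV_imp_deriv)
  moreover have "drag_dv \<alpha> x v p \<bullet> h = D (h, 0)"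
    unfolding drag_dv_def by (rule gradient_has_derivative[OF v])
  ultimately show ?thesis
    using D.add[of "(h, 0)" "(0, r)"] D0[of r] by simp
qed

text \<open>Although the drag itself need not be differentiable at vanishing velocity, the dissipation
  density \<open>\<alpha> |w|\<^sup>2 / 2\<close> is: there it is a bounded multiple of \<open>|w|\<^sup>2\<close> and has derivative zero.\<close>

lemma dissipation_line_derivative:
  fixes \<alpha> :: "real ^ 'n \<Rightarrow> real ^ 'n \<Rightarrow> real \<Rightarrow> real" and v h :: "real ^ 'n" and p r :: real
  assumes reg: "regular_drag \<Omega> \<alpha>" and x: "x \<in> closure \<Omega>"
  defines "w \<equiv> \<lambda>e. v + e *\<^sub>R h" and "q \<equiv> \<lambda>e. p + e * r"
  shows "((\<lambda>e. 1/2 * \<alpha> x (w e) (q e) * (w e \<bullet> w e)) has_real_derivative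
     1/2 * (drag_dv \<alpha> x (w e) (q e) \<bullet> h + drag_dp \<alpha> x (w e) (q e) * r) * (w e \<bullet> w e)
       + \<alpha> x (w e) (q e) * (w e \<bullet> h)) (at e)"
proof (cases "w e = 0")
  case False
  obtain A :: "(real ^ 'n) \<times> (real ^ 'n) \<times> real \<Rightarrow> ((real ^ 'n) \<times> real) \<Rightarrow>\<^sub>L real"
    where A: "\<And>x v p. x \<in> closure \<Omega> \<Longrightarrow> v \<noteq> 0 \<Longrightarrow>
           ((\<lambda>(w, q). \<alpha> x w q) has_derivative blinfun_apply (A (x, v, p))) (at (v, p))"
      and "continuous_on (closure \<Omega> \<times> (- {0}) \<times> UNIV) A"
      and "\<And>S. bounded S \<Longrightarrow> bounded (A ` (S \<inter> (closure \<Omega> \<times> (- {0}) \<times> UNIV)))"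
    using that by (rule regular_dragE[OF reg])
  define D where "D = A (x, w e, q e)"
  have D: "((\<lambda>(w, q). \<alpha> x w q) has_derivative blinfun_apply D) (at (w e, q e))"
    unfolding D_def by (rule A[OF x False])
  have "((\<lambda>e. (w e, q e)) has_derivative (\<lambda>t. t *\<^sub>R (h, r))) (at e)"
    unfolding w_def q_def by (auto intro!: derivative_eq_intros)
  from has_derivative_compose[OF this D]
  have "((\<lambda>e. \<alpha> x (w e) (q e)) has_derivative (\<lambda>t. t * D (h, r))) (at e)"
    by (simp add: blinfun.scaleR_right del: scaleR_Pair)
  then have a: "((\<lambda>e. \<alpha> x (w e) (q e)) has_real_derivative D (h, r)) (at e)"
    by (simp add: has_field_derivative_def mult.commute[of _ "D (h, r)"])
  have "(w has_derivative (\<lambda>t. t *\<^sub>R h)) (at e)"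
    unfolding w_def by (auto intro!: derivative_eq_intros)
  from has_derivative_inner[OF this this]
  have b: "((\<lambda>e. w e \<bullet> w e) has_real_derivative 2 * (w e \<bullet> h)) (at e)"
    by (simp add: has_field_derivative_def inner_commute mult_commute_abs algebra_simps)
  have "D (h, r) = drag_dv \<alpha> x (w e) (q e) \<bullet> h + drag_dp \<alpha> x (w e) (q e) * r"
    using drag_partials[where \<alpha> = \<alpha> and x = x and v = "w e" and p = "q e", OF D] .
  then show ?thesis
    by (intro DERIV_cong[OF DERIV_mult[OF DERIV_cmult[OF a, of "1/2"] b]]) simp
next
  case True
  have "v = - e *\<^sub>R h" using True by (simp add: w_def eq_neg_iff_add_eq_0)
  then have w: "w t = (t - e) *\<^sub>R h" for t
    by (simp add: w_def algebra_simps)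
  have cont: "continuous_on UNIV (\<lambda>t. \<alpha> x (w t) (q t))"
  proof -
    have "continuous_on (closure \<Omega> \<times> UNIV) (\<lambda>(x, v, p). \<alpha> x v p)"
      using reg by (simp add: regular_drag_def)
    moreover have "continuous_on UNIV (\<lambda>t. (x, w t, q t))"
      unfolding w_def q_def by (intro continuous_intros)
    ultimately have "continuous_on UNIV (\<lambda>t. (\<lambda>(x, v, p). \<alpha> x v p) (x, w t, q t))"
      by (rule continuous_on_compose2) (use x in auto)
    then show ?thesis by simp
  qed
  \<comment> \<open>the difference quotient at \<open>e\<close>\<close>
  let ?g = "\<lambda>t. 1/2 * \<alpha> x (w t) (q t) * (t - e) * (h \<bullet> h)"
  have "((\<lambda>e. 1/2 * \<alpha> x (w e) (q e) * (w e \<bullet> w e)) has_real_derivative 0) (at e)"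
    unfolding CARAT_DERIV
  proof (intro exI[of _ ?g] conjI allI)
    have "continuous_on UNIV ?g" by (intro continuous_intros cont)
    then show "isCont ?g e" by (simp add: continuous_on_eq_continuous_at)
  qed (simp_all add: w)
  then show ?thesis using True by simp
qed

text \<open>The derivative of the dissipation density along the line is bounded for parameters in
  \<open>[-1, 1]\<close>, uniformly in the position and even if the line runs through \<open>w = 0\<close>, because the
  derivative of a regular drag is bounded on bounded sets. By the mean value theorem this gives the
  Lipschitz bound needed for differentiation under the integral.\<close>

lemma dissipation_integral_derivative:
  fixes \<alpha> :: "real ^ 'n \<Rightarrow> real ^ 'n \<Rightarrow> real \<Rightarrow> real"
  assumes dom: "open \<Omega>" "bounded \<Omega>" and reg: "regular_drag \<Omega> \<alpha>"
    and v: "continuous_on (closure \<Omega>) v" and p: "continuous_on (closure \<Omega>) p"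
    and h: "continuous_on (closure \<Omega>) h" and r: "continuous_on (closure \<Omega>) r"
  defines "L \<equiv> \<lambda>x. 1/2 * (drag_dv \<alpha> x (v x) (p x) \<bullet> h x + drag_dp \<alpha> x (v x) (p x) * r x) * (v x \<bullet> v x)"
  shows "((\<lambda>e. LINT x:\<Omega>|lborel. 1/2 * \<alpha> x (v x + e *\<^sub>R h x) (p x + e * r x)
                * ((v x + e *\<^sub>R h x) \<bullet> (v x + e *\<^sub>R h x)))
          has_real_derivative (LINT x:\<Omega>|lborel. L x + \<alpha> x (v x) (p x) * (v x \<bullet> h x))) (at 0)"
    and "set_integrable lborel \<Omega> (\<lambda>x. L x + \<alpha> x (v x) (p x) * (v x \<bullet> h x))"
proof -
  let ?w = "\<lambda>e x. v x + e *\<^sub>R h x" and ?q = "\<lambda>e x. p x + e * r x"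
  let ?F = "\<lambda>e x. 1/2 * \<alpha> x (?w e x) (?q e x) * (?w e x \<bullet> ?w e x)"
  let ?F' = "\<lambda>e x. 1/2 * (drag_dv \<alpha> x (?w e x) (?q e x) \<bullet> h x + drag_dp \<alpha> x (?w e x) (?q e x) * r x)
      * (?w e x \<bullet> ?w e x) + \<alpha> x (?w e x) (?q e x) * (?w e x \<bullet> h x)"
  have comp: "compact (closure \<Omega>)" using dom by simp
  have bdd: "\<exists>B>0. \<forall>x\<in>closure \<Omega>. norm (f x) \<le> B"
    if "continuous_on (closure \<Omega>) f" for f :: "real ^ 'n \<Rightarrow> 'b::real_normed_vector"
    using compact_imp_bounded[OF compact_continuous_image[OF that comp]]
    unfolding bounded_pos by auto
  obtain Bv where Bv: "Bv > 0" "\<And>x. x \<in> closure \<Omega> \<Longrightarrow> norm (v x) \<le> Bv" using bdd[OF v] by blast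
  obtain Bp where Bp: "Bp > 0" "\<And>x. x \<in> closure \<Omega> \<Longrightarrow> norm (p x) \<le> Bp" using bdd[OF p] by blast
  obtain Bh where Bh: "Bh > 0" "\<And>x. x \<in> closure \<Omega> \<Longrightarrow> norm (h x) \<le> Bh" using bdd[OF h] by blast
  obtain Br where Br: "Br > 0" "\<And>x. x \<in> closure \<Omega> \<Longrightarrow> norm (r x) \<le> Br" using bdd[OF r] by blast
  have B: "Bv > 0" "Bp > 0" "Bh > 0" "Br > 0"
     "\<And>x. x \<in> closure \<Omega> \<Longrightarrow> norm (v x) \<le> Bv \<and> norm (p x) \<le> Bp \<and> norm (h x) \<le> Bh \<and> norm (r x) \<le> Br"
    using Bv Bp Bh Br by auto
  define R where "R = Bv + Bh"
  define P where "P = Bp + Br"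
  have wq: "norm (?w e x) \<le> R" "norm (?q e x) \<le> P" if "x \<in> closure \<Omega>" "\<bar>e\<bar> \<le> 1" for e x
  proof -
    have "norm (?w e x) \<le> norm (v x) + \<bar>e\<bar> * norm (h x)"
      using norm_triangle_ineq[of "v x" "e *\<^sub>R h x"] by simp
    also have "\<bar>e\<bar> * norm (h x) \<le> 1 * Bh" using that B by (intro mult_mono) auto
    finally show "norm (?w e x) \<le> R" using B(5)[OF that(1)] by (simp add: R_def)
    have "norm (?q e x) \<le> norm (p x) + \<bar>e\<bar> * norm (r x)"
      using norm_triangle_ineq[of "p x" "e * r x"] by (simp add: abs_mult)
    also have "\<bar>e\<bar> * norm (r x) \<le> 1 * Br" using that B by (intro mult_mono) auto
    finally show "norm (?q e x) \<le> P" using B(5)[OF that(1)] by (simp add: P_def)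
  qed
  let ?S = "closure \<Omega> \<times> (cball 0 R :: (real ^ 'n) set) \<times> (cball 0 P :: real set)"
  have "compact ?S" using comp by (intro compact_Times) auto
  moreover have "continuous_on ?S (\<lambda>(x, v, p). \<alpha> x v p)"
    using reg unfolding regular_drag_def by (auto elim!: continuous_on_subset)
  ultimately have "bounded ((\<lambda>(x, v, p). \<alpha> x v p) ` ?S)"
    by (intro compact_imp_bounded compact_continuous_image)
  then obtain a where a0: "a > 0" "\<forall>y\<in>(\<lambda>(x, v, p). \<alpha> x v p) ` ?S. norm y \<le> a"
    unfolding bounded_pos by blast
  have a: "\<bar>\<alpha> x w q\<bar> \<le> a" if "x \<in> closure \<Omega>" "norm w \<le> R" "norm q \<le> P" for x w q
    using bspec[OF a0(2) imageI[of "(x, w, q)"]] that by simp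
  obtain A :: "(real ^ 'n) \<times> (real ^ 'n) \<times> real \<Rightarrow> ((real ^ 'n) \<times> real) \<Rightarrow>\<^sub>L real"
    where A: "\<And>x v p. x \<in> closure \<Omega> \<Longrightarrow> v \<noteq> 0 \<Longrightarrow>
           ((\<lambda>(w, q). \<alpha> x w q) has_derivative blinfun_apply (A (x, v, p))) (at (v, p))"
      and "continuous_on (closure \<Omega> \<times> (- {0}) \<times> UNIV) A"
      and A_bdd: "\<And>S. bounded S \<Longrightarrow> bounded (A ` (S \<inter> (closure \<Omega> \<times> (- {0}) \<times> UNIV)))"
    using that by (rule regular_dragE[OF reg])
  have "bounded (A ` (?S \<inter> (closure \<Omega> \<times> (- {0}) \<times> UNIV)))"
    using \<open>compact ?S\<close> by (intro A_bdd compact_imp_bounded)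
  then obtain b where b0: "b > 0" "\<forall>y\<in>A ` (?S \<inter> (closure \<Omega> \<times> (- {0}) \<times> UNIV)). norm y \<le> b"
    unfolding bounded_pos by blast
  have b: "norm (A (x, w, q)) \<le> b" if "x \<in> closure \<Omega>" "norm w \<le> R" "norm q \<le> P" "w \<noteq> 0" for x w q
    using bspec[OF b0(2) imageI[of "(x, w, q)"]] that by simp
  define C where "C = 1/2 * (b * (Bh + Br)) * (R * R) + a * (R * Bh)"
  have R0: "R > 0" using B by (simp add: R_def)
  have C: "\<bar>?F' e x\<bar> \<le> C" if x: "x \<in> closure \<Omega>" and e: "\<bar>e\<bar> \<le> 1" for e x
  proof -
    note hr = B(5)[OF x]
    have wR: "norm (?w e x) \<le> R" and qP: "norm (?q e x) \<le> P" using wq[OF x e] by auto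
    have ww: "?w e x \<bullet> ?w e x \<le> R * R"
      using mult_mono[OF wR wR] R0 by (simp add: dot_square_norm power2_eq_square)
    have "\<bar>?w e x \<bullet> h x\<bar> \<le> norm (?w e x) * norm (h x)" by (rule Cauchy_Schwarz_ineq2)
    also have "\<dots> \<le> R * Bh" using wR hr R0 by (intro mult_mono) auto
    finally have wh: "\<bar>?w e x \<bullet> h x\<bar> \<le> R * Bh" .
    have 2: "\<bar>\<alpha> x (?w e x) (?q e x) * (?w e x \<bullet> h x)\<bar> \<le> a * (R * Bh)"
      unfolding abs_mult using a[OF x wR qP] wh a0(1) by (intro mult_mono) auto
    have 1: "\<bar>1/2 * (drag_dv \<alpha> x (?w e x) (?q e x) \<bullet> h x + drag_dp \<alpha> x (?w e x) (?q e x) * r x)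
        * (?w e x \<bullet> ?w e x)\<bar> \<le> 1/2 * (b * (Bh + Br)) * (R * R)"
    proof (cases "?w e x = 0")
      case True
      then show ?thesis using b0(1) B R0 by simp
    next
      case False
      have "\<bar>drag_dv \<alpha> x (?w e x) (?q e x) \<bullet> h x + drag_dp \<alpha> x (?w e x) (?q e x) * r x\<bar>
          = norm (A (x, ?w e x, ?q e x) (h x, r x))"
        by (simp add: drag_partials[where \<alpha> = \<alpha> and x = x and v = "?w e x" and p = "?q e x", OF A[OF x False]])
      also have "\<dots> \<le> norm (A (x, ?w e x, ?q e x)) * norm (h x, r x)"
        by (rule norm_blinfun)
      also have "\<dots> \<le> b * (Bh + Br)"
        using b0(1) b[OF x wR qP False] norm_Pair_le[of "h x" "r x"] hr
        by (intro mult_mono) auto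
      finally show ?thesis
        unfolding abs_mult using ww b0(1) B by (intro mult_mono) auto
    qed
    show ?thesis using 1 2 unfolding C_def by linarith
  qed
  have F: "((\<lambda>e. ?F e x) has_real_derivative ?F' e x) (at e)" if "x \<in> closure \<Omega>" for e x
    using dissipation_line_derivative[OF reg that] .
  have int: "set_integrable lborel \<Omega> (?F e)" for e
    by (intro set_integrable_continuous_on_closure dom continuous_intros v p h r
        regular_drag_continuous[OF reg order_refl])
  have F0: "((\<lambda>e. ?F e x) has_real_derivative (L x + \<alpha> x (v x) (p x) * (v x \<bullet> h x))) (at 0)"
    if "x \<in> \<Omega>" for x
    using F[of x 0] that closure_subset by (auto simp: L_def)
  have lip: "\<bar>?F e x - ?F 0 x\<bar> \<le> C * \<bar>e\<bar>" if "x \<in> \<Omega>" "\<bar>e\<bar> \<le> 1" for e x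
  proof -
    have x: "x \<in> closure \<Omega>" using that closure_subset by auto
    have "norm (?F e x - ?F 0 x) \<le> C * norm (e - 0)"
    proof (rule field_differentiable_bound[of "{-1..1}" "\<lambda>e. ?F e x" "\<lambda>e. ?F' e x"])
      show "norm (?F' t x) \<le> C" if "t \<in> {-1..1}" for t
        using C[OF x, of t] that by (simp add: abs_le_iff)
    qed (use that F[OF x] in \<open>auto intro: has_field_derivative_at_within\<close>)
    then show ?thesis by simp
  qed
  have S: "\<Omega> \<in> sets lborel" "emeasure lborel \<Omega> < \<infinity>"
    using dom emeasure_bounded_finite by auto
  show "((\<lambda>e. LINT x:\<Omega>|lborel. ?F e x)
          has_real_derivative (LINT x:\<Omega>|lborel. L x + \<alpha> x (v x) (p x) * (v x \<bullet> h x))) (at 0)"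
    by (rule has_derivative_set_integral_parameter(1)[where C = C, OF S int F0 lip])
  show "set_integrable lborel \<Omega> (\<lambda>x. L x + \<alpha> x (v x) (p x) * (v x \<bullet> h x))"
    by (rule has_derivative_set_integral_parameter(2)[where C = C, OF S int F0 lip])
qed

text \<open>The integrand is bounded, as the normal has unit length almost everywhere, and the boundary
  has finite area.\<close>

lemma boundary_integrable:
  fixes n :: "real ^ 'n \<Rightarrow> real ^ 'n"
  assumes dom: "regular_domain \<Omega> n" and G: "G \<in> sets borel" "G \<subseteq> frontier \<Omega>"
    and u: "continuous_on (closure \<Omega>) u"
  shows "set_integrable surface_measure G (\<lambda>x. u x \<bullet> n x)"
proof -
  have cl: "G \<subseteq> closure \<Omega>" using G by (auto simp: frontier_def)
  have fin: "emeasure surface_measure G < \<infinity>"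
    using dom G le_less_trans[OF emeasure_mono[of G "frontier \<Omega>" surface_measure]]
    by (auto simp: regular_domain_def sets_hausdorff_measure)
  have n[measurable]: "n \<in> borel_measurable borel" using dom by (simp add: regular_domain_def)
  have "compact (u ` closure \<Omega>)"
    using dom u by (intro compact_continuous_image) (auto simp: regular_domain_def)
  then have "bounded (u ` closure \<Omega>)" by (rule compact_imp_bounded)
  then obtain B where B: "\<And>x. x \<in> closure \<Omega> \<Longrightarrow> norm (u x) \<le> B" by (auto simp: bounded_iff)
  have 1: "(\<lambda>x. indicator G x *\<^sub>R u x) \<in> borel_measurable borel"
    using G u cl by (intro borel_measurable_continuous_on_indicator) (auto intro: continuous_on_subset)
  have 2: "(\<lambda>x. (indicator G x *\<^sub>R u x) \<bullet> n x) \<in> borel_measurable borel"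
    by (intro borel_measurable_inner 1 n)
  have meas: "borel_measurable surface_measure = borel_measurable borel"
    by (rule measurable_cong_sets) (simp_all add: sets_hausdorff_measure)
  have "AE x in surface_measure. x \<in> frontier \<Omega> \<longrightarrow> outward_unit_normal \<Omega> x (n x)"
    using dom by (simp add: regular_domain_def)
  then have 3: "AE x in surface_measure. x \<in> G \<longrightarrow> norm ((indicator G x *\<^sub>R u x) \<bullet> n x) \<le> B"
  proof eventually_elim
    case (elim x)
    show ?case
    proof
      assume x: "x \<in> G"
      then have "norm (n x) = 1" using elim G by (auto simp: outward_unit_normal_def)
      then have "\<bar>u x \<bullet> n x\<bar> \<le> norm (u x)" using Cauchy_Schwarz_ineq2[of "u x" "n x"] by simp
      with B[of x] x cl show "norm ((indicator G x *\<^sub>R u x) \<bullet> n x) \<le> B" by auto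
    qed
  qed
  have "integrable surface_measure (\<lambda>x. (indicator G x *\<^sub>R u x) \<bullet> n x)"
  proof (rule integrableI_bounded_set[OF _ _ fin 3])
    show "G \<in> sets surface_measure" using G by (simp only: sets_hausdorff_measure)
    show "(\<lambda>x. (indicator G x *\<^sub>R u x) \<bullet> n x) \<in> borel_measurable surface_measure"
      unfolding meas by (rule 2)
    show "AE x in surface_measure. x \<notin> G \<longrightarrow> (indicator G x *\<^sub>R u x) \<bullet> n x = 0"
      by (intro AE_I2) simp
  qed
  then show ?thesis by (simp add: set_integrable_def)
qed

text \<open>The divergence theorem for \<open>p \<delta>v\<close>. The boundary integral lives on \<open>\<Gamma>\<^sup>p\<close> since
  \<open>\<delta>v\<close> is tangential on \<open>\<Gamma>\<^sup>v\<close>.\<close>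

lemma pressure_work:
  fixes n :: "real ^ 'n \<Rightarrow> real ^ 'n"
  assumes dom: "regular_domain \<Omega> n" and bdy: "boundary_partition \<Omega> \<Gamma>v \<Gamma>p"
    and p: "C1_on_closure \<Omega> p" and h: "h \<in> velocity_variations \<Omega> n \<Gamma>v"
    and p0: "\<And>x. x \<in> \<Gamma>p \<Longrightarrow> p x = p\<^sub>0 x"
  shows "(LINT x:\<Gamma>p|surface_measure. (h x \<bullet> n x) * p\<^sub>0 x)
     = (LINT x:\<Omega>|lborel. h x \<bullet> gradient p x + p x * divergence h x)"
proof -
  have hC: "C1_on_closure \<Omega> h" and h0: "AE x in surface_measure. x \<in> \<Gamma>v \<longrightarrow> h x \<bullet> n x = 0"
    using h by (auto simp: velocity_variations_def velocity_space_def)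
  have phC: "C1_on_closure \<Omega> (\<lambda>x. p x *\<^sub>R h x)" using p hC by (rule C1_on_closure_scaleR)
  have fr: "\<Gamma>v \<union> \<Gamma>p = frontier \<Omega>" and disj: "\<Gamma>v \<inter> \<Gamma>p = {}"
    and sets: "\<Gamma>v \<in> sets borel" "\<Gamma>p \<in> sets borel"
    using bdy by (auto simp: boundary_partition_def)
  have int: "set_integrable surface_measure \<Gamma>v (\<lambda>x. (p x *\<^sub>R h x) \<bullet> n x)"
      "set_integrable surface_measure \<Gamma>p (\<lambda>x. (p x *\<^sub>R h x) \<bullet> n x)"
    by (rule boundary_integrable[OF dom _ _ C1_on_closure_continuous[OF phC]]; use fr sets in blast)+
  have "(LINT x:\<Gamma>v|surface_measure. (p x *\<^sub>R h x) \<bullet> n x) = 0"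
    unfolding set_lebesgue_integral_def
    by (rule integral_eq_zero_AE) (use h0 in eventually_elim, auto simp: indicator_def)
  moreover have "(LINT x:\<Gamma>p|surface_measure. (p x *\<^sub>R h x) \<bullet> n x)
      = (LINT x:\<Gamma>p|surface_measure. (h x \<bullet> n x) * p\<^sub>0 x)"
    by (rule set_lebesgue_integral_cong)
       (use sets p0 in \<open>auto simp: sets_hausdorff_measure\<close>)
  ultimately have "(LINT x:frontier \<Omega>|surface_measure. (p x *\<^sub>R h x) \<bullet> n x)
      = (LINT x:\<Gamma>p|surface_measure. (h x \<bullet> n x) * p\<^sub>0 x)"
    using set_integral_Un[OF disj int] fr by simp
  moreover have "(LINT x:\<Omega>|lborel. divergence (\<lambda>x. p x *\<^sub>R h x) x)
      = (LINT x:frontier \<Omega>|surface_measure. (p x *\<^sub>R h x) \<bullet> n x)"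
    using dom phC by (auto simp: regular_domain_def)
  moreover have "(LINT x:\<Omega>|lborel. divergence (\<lambda>x. p x *\<^sub>R h x) x)
      = (LINT x:\<Omega>|lborel. h x \<bullet> gradient p x + p x * divergence h x)"
  proof (rule set_lebesgue_integral_cong)
    show "\<Omega> \<in> sets lborel" using dom by (simp add: regular_domain_def)
    show "\<forall>x. x \<in> \<Omega> \<longrightarrow> divergence (\<lambda>x. p x *\<^sub>R h x) x = h x \<bullet> gradient p x + p x * divergence h x"
    proof safe
      fix x assume x: "x \<in> \<Omega>"
      obtain D where "(p has_derivative D) (at x)" using C1_on_closure_has_derivative[OF p x] by blast
      moreover obtain E where "(h has_derivative E) (at x)" using C1_on_closure_has_derivative[OF hC x] by blast
      ultimately show "divergence (\<lambda>x. p x *\<^sub>R h x) x = h x \<bullet> gradient p x + p x * divergence h x"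
        by (simp add: divergence_scaleR_field)
    qed
  qed
  ultimately show ?thesis by simp
qed

text \<open>Varying the dissipation yields the wanted integral plus the power \<open>\<alpha> v \<bullet> \<delta>v\<close> of the drag.
  By the flow equation, the latter and the work of the body force leave \<open>- \<delta>v \<bullet> grad p\<close>, which
  cancels against the boundary term and the constraint term by \<open>pressure_work\<close>. The variation of
  the multiplier contributes nothing, as \<open>v\<close> is divergence free.\<close>

lemma lagrangian_derivative:
  fixes n :: "real ^ 'n \<Rightarrow> real ^ 'n"
  assumes dom: "regular_domain \<Omega> n" and bdy: "boundary_partition \<Omega> \<Gamma>v \<Gamma>p"
    and reg: "regular_drag \<Omega> \<alpha>" and sol: "flow_solution \<Omega> n \<Gamma>v \<Gamma>p \<rho> b vn p\<^sub>0 \<alpha> v p"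
    and h: "h \<in> velocity_variations \<Omega> n \<Gamma>v" and r: "r \<in> pressure_space \<Omega>"
  shows "(lagrangian_along \<Omega> n \<Gamma>p \<rho> b p\<^sub>0 \<alpha> v p h r
      has_real_derivative drag_variation_integral \<Omega> \<alpha> v p h r) (at 0)"
proof -
  have op: "open \<Omega>" and bd: "bounded \<Omega>" and \<Omega>: "\<Omega> \<in> sets lborel"
    using dom by (auto simp: regular_domain_def)
  have C1: "C1_on_closure \<Omega> v" "C1_on_closure \<Omega> p" "C1_on_closure \<Omega> h" "C1_on_closure \<Omega> r"
    using sol h r by (auto simp: flow_solution_def velocity_variations_def velocity_space_def
        pressure_space_def)
  note cont = C1[THEN C1_on_closure_continuous]
  have flow: "\<rho> *\<^sub>R b x = \<alpha> x (v x) (p x) *\<^sub>R v x + gradient p x" "divergence v x = 0"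
    if "x \<in> \<Omega>" for x using sol that by (auto simp: flow_solution_def)
  have p0: "p x = p\<^sub>0 x" if "x \<in> \<Gamma>p" for x using sol that by (auto simp: flow_solution_def)
  have fr: "\<Gamma>p \<subseteq> frontier \<Omega>" "\<Gamma>p \<in> sets borel" using bdy by (auto simp: boundary_partition_def)
  obtain g where g: "continuous_on (closure \<Omega>) g" "\<And>x. x \<in> \<Omega> \<Longrightarrow> gradient p x = g x"
    using continuous_on_gradient[OF C1(2)] by metis
  obtain d where d: "continuous_on (closure \<Omega>) d" "\<And>x. x \<in> \<Omega> \<Longrightarrow> divergence h x = d x"
    using continuous_on_divergence[OF C1(3)] by metis
  define a where "a x = \<alpha> x (v x) (p x)" for x
  have a: "continuous_on (closure \<Omega>) a"
    unfolding a_def using regular_drag_continuous[OF reg order_refl] cont by simp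
  have div: "divergence (\<lambda>x. v x + e *\<^sub>R h x) x = e * d x" if x: "x \<in> \<Omega>" for e x
  proof -
    obtain D where D: "(v has_derivative D) (at x)" using C1_on_closure_has_derivative[OF C1(1) x] by blast
    obtain E where E: "(h has_derivative E) (at x)" using C1_on_closure_has_derivative[OF C1(3) x] by blast
    show ?thesis
      using divergence_add_scaleR[OF D E, of e] flow(2)[OF x] d(2)[OF x] by simp
  qed
  note I = set_integrable_continuous_on_closure[OF op bd]
  \<comment> \<open>The body force is arbitrary outside the domain; inside it agrees with a field that is
    continuous up to the boundary and therefore integrable.\<close>
  define f where "f x = a x *\<^sub>R v x + g x" for x
  have f: "continuous_on (closure \<Omega>) f"
    unfolding f_def by (intro continuous_intros a g cont)
  define K where "K e = (LINT x:\<Omega>|lborel. 1/2 * \<alpha> x (v x + e *\<^sub>R h x) (p x + e * r x)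
                * ((v x + e *\<^sub>R h x) \<bullet> (v x + e *\<^sub>R h x)))" for e
  define L where "L x = 1/2 * (drag_dv \<alpha> x (v x) (p x) \<bullet> h x + drag_dp \<alpha> x (v x) (p x) * r x)
      * (v x \<bullet> v x)" for x
  define F where "F = (LINT x:\<Omega>|lborel. v x \<bullet> f x)"
  define F1 where "F1 = (LINT x:\<Omega>|lborel. h x \<bullet> f x)"
  define P where "P = (LINT x:\<Gamma>p|surface_measure. (v x \<bullet> n x) * p\<^sub>0 x)"
  define P1 where "P1 = (LINT x:\<Gamma>p|surface_measure. (h x \<bullet> n x) * p\<^sub>0 x)"
  define V where "V = (LINT x:\<Omega>|lborel. p x * d x)"
  define V1 where "V1 = (LINT x:\<Omega>|lborel. r x * d x)"
  have force: "(LINT x:\<Omega>|lborel. (v x + e *\<^sub>R h x) \<bullet> (\<rho> *\<^sub>R b x)) = F + e * F1" for e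
  proof -
    have "(LINT x:\<Omega>|lborel. (v x + e *\<^sub>R h x) \<bullet> (\<rho> *\<^sub>R b x))
        = (LINT x:\<Omega>|lborel. v x \<bullet> f x + e * (h x \<bullet> f x))"
      by (rule set_lebesgue_integral_cong[OF \<Omega>])
         (auto simp: flow(1) g(2) f_def a_def inner_add_left)
    also have "\<dots> = F + e * F1"
      unfolding F_def F1_def
      by (subst set_integral_add) (auto intro!: I continuous_intros cont f)
    finally show ?thesis .
  qed
  have bint: "set_integrable surface_measure \<Gamma>p (\<lambda>x. (u x \<bullet> n x) * p\<^sub>0 x)"
    if "continuous_on (closure \<Omega>) u" for u
  proof -
    have "set_integrable surface_measure \<Gamma>p (\<lambda>x. (p x *\<^sub>R u x) \<bullet> n x)"
      by (intro boundary_integrable[OF dom fr(2,1)] continuous_intros cont that)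
    then show ?thesis
      by (rule set_integrable_cong[THEN iffD1, rotated 3]) (auto simp: p0)
  qed
  have bdry: "(LINT x:\<Gamma>p|surface_measure. ((v x + e *\<^sub>R h x) \<bullet> n x) * p\<^sub>0 x) = P + e * P1" for e
  proof -
    have "(LINT x:\<Gamma>p|surface_measure. ((v x + e *\<^sub>R h x) \<bullet> n x) * p\<^sub>0 x)
       = (LINT x:\<Gamma>p|surface_measure. (v x \<bullet> n x) * p\<^sub>0 x + e * ((h x \<bullet> n x) * p\<^sub>0 x))"
      by (simp add: inner_add_left algebra_simps)
    also have "\<dots> = P + e * P1"
    proof -
      have "set_integrable surface_measure \<Gamma>p (\<lambda>x. e * ((h x \<bullet> n x) * p\<^sub>0 x))"
        by (intro set_integrable_mult_right bint cont)
      from set_integral_add(2)[OF bint[OF cont(1)] this] show ?thesis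
        by (simp only: set_integral_mult_right P_def P1_def)
    qed
    finally show ?thesis .
  qed
  have constraint: "(LINT x:\<Omega>|lborel. (p x + e * r x) * divergence (\<lambda>x. v x + e *\<^sub>R h x) x)
      = e * V + e\<^sup>2 * V1" for e
  proof -
    have "(LINT x:\<Omega>|lborel. (p x + e * r x) * divergence (\<lambda>x. v x + e *\<^sub>R h x) x)
       = (LINT x:\<Omega>|lborel. e * (p x * d x) + e\<^sup>2 * (r x * d x))"
      by (rule set_lebesgue_integral_cong[OF \<Omega>])
         (auto simp: div power2_eq_square algebra_simps)
    also have "\<dots> = e * V + e\<^sup>2 * V1"
      unfolding V_def V1_def
      by (subst set_integral_add) (auto intro!: I continuous_intros cont d)
    finally show ?thesis .
  qed
  have along: "lagrangian_along \<Omega> n \<Gamma>p \<rho> b p\<^sub>0 \<alpha> v p h r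
      = (\<lambda>e. K e - (F + e * F1) + (P + e * P1) - (e * V + e\<^sup>2 * V1))"
    by (rule ext) (simp only: lagrangian_along_def lagrangian_def power_functional_def
        force bdry constraint K_def)
  define K' where "K' = (LINT x:\<Omega>|lborel. L x + a x * (v x \<bullet> h x))"
  have K: "(K has_real_derivative K') (at 0)"
    unfolding K_def K'_def L_def a_def
    by (rule dissipation_integral_derivative(1)[OF op bd reg cont])
  have Lint: "set_integrable lborel \<Omega> (\<lambda>x. L x + a x * (v x \<bullet> h x))"
    unfolding L_def a_def
    by (rule dissipation_integral_derivative(2)[OF op bd reg cont])
  have av: "set_integrable lborel \<Omega> (\<lambda>x. a x * (v x \<bullet> h x))"
    by (intro I continuous_intros a cont)
  have "set_integrable lborel \<Omega> L"
    using set_integral_diff(1)[OF Lint av] by simp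
  then have K': "K' = drag_variation_integral \<Omega> \<alpha> v p h r + (LINT x:\<Omega>|lborel. a x * (v x \<bullet> h x))"
    unfolding K'_def drag_variation_integral_def L_def[symmetric]
    using av by (rule set_integral_add)
  have "P1 = (LINT x:\<Omega>|lborel. h x \<bullet> gradient p x + p x * divergence h x)"
    unfolding P1_def using pressure_work[OF dom bdy C1(2) h p0] .
  also have "\<dots> = (LINT x:\<Omega>|lborel. h x \<bullet> g x + p x * d x)"
    by (rule set_lebesgue_integral_cong[OF \<Omega>]) (simp add: g d)
  also have "\<dots> = (LINT x:\<Omega>|lborel. h x \<bullet> g x) + V"
    unfolding V_def by (intro set_integral_add I continuous_intros cont g d)
  finally have P1: "P1 = (LINT x:\<Omega>|lborel. h x \<bullet> g x) + V" .
  have "F1 = (LINT x:\<Omega>|lborel. a x * (v x \<bullet> h x) + h x \<bullet> g x)"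
    unfolding F1_def f_def by (simp add: inner_add_right inner_commute)
  also have "\<dots> = (LINT x:\<Omega>|lborel. a x * (v x \<bullet> h x)) + (LINT x:\<Omega>|lborel. h x \<bullet> g x)"
    by (intro set_integral_add I continuous_intros cont g a)
  finally have F1: "F1 = \<dots>" .
  show ?thesis
    unfolding along
    by (rule DERIV_cong, (rule derivative_intros K)+)
       (simp add: K' P1 F1)
qed

section \<open>Test fields\<close>

text \<open>Squaring the positive part of \<open>s\<^sup>2 - |x - c|\<^sup>2\<close> makes this continuously differentiable across
  the sphere of radius \<open>s\<close>.\<close>

definition bump :: "real ^ 'n \<Rightarrow> real \<Rightarrow> real ^ 'n \<Rightarrow> real" where
  "bump c s x = (max 0 (s\<^sup>2 - (x - c) \<bullet> (x - c)))\<^sup>2"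

definition bump_deriv :: "real ^ 'n \<Rightarrow> real \<Rightarrow> real ^ 'n \<Rightarrow> real ^ 'n \<Rightarrow> real" where
  "bump_deriv c s x h = - 4 * max 0 (s\<^sup>2 - (x - c) \<bullet> (x - c)) * ((x - c) \<bullet> h)"

lemma has_real_derivative_max_zero_power2:
  "((\<lambda>t::real. (max 0 t)\<^sup>2) has_real_derivative 2 * max 0 t) (at t)"
proof -
  consider "t < 0" | "t > 0" | "t = 0" by linarith
  then show ?thesis
  proof cases
    case 1
    have "((\<lambda>t. 0) has_real_derivative 0) (at t)" by simp
    then have "((\<lambda>t::real. (max 0 t)\<^sup>2) has_real_derivative 0) (at t)"
      by (rule has_field_derivative_transform_within_open[where S = "{..<0}"]) (use 1 in auto)
    then show ?thesis using 1 by simp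
  next
    case 2
    have "((\<lambda>t. t\<^sup>2) has_real_derivative 2 * t) (at t)" by (auto intro!: derivative_eq_intros)
    then have "((\<lambda>t::real. (max 0 t)\<^sup>2) has_real_derivative 2 * t) (at t)"
      by (rule has_field_derivative_transform_within_open[where S = "{0<..}"]) (use 2 in auto)
    then show ?thesis using 2 by simp
  next
    case 3
    have "((\<lambda>t::real. (max 0 t)\<^sup>2) has_real_derivative 0) (at 0)"
      unfolding CARAT_DERIV
    proof (intro exI[of _ "\<lambda>t. max 0 t"] conjI allI)
      show "(max 0 z)\<^sup>2 - (max 0 0)\<^sup>2 = max 0 z * (z - 0)" for z :: real
        by (simp add: max_def power2_eq_square)
    qed (auto intro!: continuous_intros)
    then show ?thesis using 3 by simp
  qed
qed

lemma bump_has_derivative: "(bump c s has_derivative bump_deriv c s x) (at x)"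
proof -
  have g: "((\<lambda>x. s\<^sup>2 - (x - c) \<bullet> (x - c)) has_derivative (\<lambda>h. - 2 * ((x - c) \<bullet> h))) (at x)"
    by (auto intro!: derivative_eq_intros simp: inner_commute)
  have "((\<lambda>x. (max 0 (s\<^sup>2 - (x - c) \<bullet> (x - c)))\<^sup>2) has_derivative
      (\<lambda>h. 2 * max 0 (s\<^sup>2 - (x - c) \<bullet> (x - c)) * (- 2 * ((x - c) \<bullet> h)))) (at x)"
    using has_derivative_compose[OF g has_real_derivative_max_zero_power2[THEN has_field_derivative_imp_has_derivative]]
    by simp
  then show ?thesis by (simp add: bump_def[abs_def] bump_deriv_def[abs_def] mult.assoc)
qed

lemma bump_nonneg: "0 \<le> bump c s x"
  by (simp add: bump_def)

lemma dist_power2_inner: "(dist c x)\<^sup>2 = (x - c) \<bullet> (x - c)"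
  by (metis dist_commute dist_norm power2_norm_eq_inner)

lemma bump_pos: "dist c x < s \<Longrightarrow> 0 < bump c s x"
proof -
  assume "dist c x < s"
  then have "(dist c x)\<^sup>2 < s\<^sup>2" by (intro power_strict_mono) auto
  then show ?thesis by (simp add: bump_def dist_power2_inner)
qed

lemma bump_outside: "0 < s \<Longrightarrow> s \<le> dist c x \<Longrightarrow> bump c s x = 0"
proof -
  assume "0 < s" "s \<le> dist c x"
  then have "s\<^sup>2 \<le> (dist c x)\<^sup>2" by (intro power_mono) auto
  then show ?thesis by (simp add: bump_def dist_power2_inner)
qed

lemma C1_on_closure_bump: "C1_on_closure \<Omega> (bump c s)"
proof (rule C1_on_closureI[where f' = "bump_deriv c s"])
  show "bounded_linear (bump_deriv c s x)" for x
    using bump_has_derivative by (rule has_derivative_bounded_linear)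
  show "continuous_on (closure \<Omega>) (bump c s)"
    unfolding bump_def[abs_def] by (intro continuous_intros)
  show "continuous_on (closure \<Omega>) (\<lambda>x. bump_deriv c s x h)" for h
    unfolding bump_deriv_def by (intro continuous_intros)
qed (rule bump_has_derivative)

text \<open>The localization argument behind the fundamental lemma of the calculus of variations.\<close>

lemma bump_integral_zero_imp_zero:
  fixes f :: "real ^ 'n \<Rightarrow> real"
  assumes U: "open U" "U \<subseteq> \<Omega>" "x0 \<in> U" and f: "continuous_on U f" and \<Omega>: "open \<Omega>"
    and zero: "\<And>s. 0 < s \<Longrightarrow> cball x0 s \<subseteq> U \<Longrightarrow> (LINT x:\<Omega>|lborel. bump x0 s x * f x) = 0"
  shows "f x0 = 0"
proof (rule ccontr)
  assume nz: "f x0 \<noteq> 0"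
  define \<sigma> where "\<sigma> = sgn (f x0)"
  have "open (U \<inter> (\<lambda>x. \<sigma> * f x) -` {0<..})"
    using U f by (intro continuous_open_preimage continuous_intros) auto
  moreover have "x0 \<in> U \<inter> (\<lambda>x. \<sigma> * f x) -` {0<..}"
    using nz U by (simp add: \<sigma>_def sgn_if)
  ultimately obtain s where s: "s > 0" "cball x0 s \<subseteq> U \<inter> (\<lambda>x. \<sigma> * f x) -` {0<..}"
    using open_contains_cball by metis
  then have sub: "cball x0 s \<subseteq> U" and pos: "\<And>x. x \<in> cball x0 s \<Longrightarrow> 0 < \<sigma> * f x" by auto
  let ?g = "\<lambda>x. bump x0 s x * (\<sigma> * f x)"
  have out: "bump x0 s x = 0" if "x \<notin> cball x0 s" for x
    using that s(1) by (intro bump_outside) auto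
  have "set_integrable lborel (cball x0 s) ?g"
    unfolding set_integrable_def
    using C1_on_closure_bump[of "cball x0 s" x0 s, THEN C1_on_closure_continuous] f sub
    by (intro borel_integrable_compact continuous_intros) (auto intro: continuous_on_subset)
  moreover have "indicator (cball x0 s) x *\<^sub>R ?g x = indicator \<Omega> x *\<^sub>R ?g x" for x
    using sub U out by (auto simp: indicator_def)
  ultimately have "set_integrable lborel \<Omega> ?g" by (simp only: set_integrable_def)
  then have "0 < (LINT x:\<Omega>|lborel. ?g x)"
  proof (rule set_integral_pos)
    show "0 \<le> ?g x" for x
      using out[of x] pos[of x] bump_nonneg[of x0 s x] by (cases "x \<in> cball x0 s") auto
    show "ball x0 s \<subseteq> \<Omega>" using ball_subset_cball[of x0 s] sub U by blast
    show "0 < ?g x" if "x \<in> ball x0 s" for x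
      using that pos[of x] bump_pos[of x0 x s] by auto
  qed (use s in auto)
  also have "(LINT x:\<Omega>|lborel. ?g x) = \<sigma> * (LINT x:\<Omega>|lborel. bump x0 s x * f x)"
    by (simp only: mult.left_commute[of _ \<sigma>] set_integral_mult_right)
  finally show False using zero[OF s(1) sub] by simp
qed

text \<open>Fields supported in the open domain vanish on its boundary and are therefore admissible
  variations for every partition of the boundary.\<close>

lemma interior_support_velocity_variation:
  assumes "open \<Omega>" "C1_on_closure \<Omega> w" "\<And>x. x \<notin> \<Omega> \<Longrightarrow> w x = 0" "\<Gamma>v \<subseteq> frontier \<Omega>"
  shows "w \<in> velocity_variations \<Omega> n \<Gamma>v"
proof -
  have "w x = 0" if "x \<in> \<Gamma>v" for x
    using assms that by (intro assms(3)) (auto simp: frontier_def interior_open)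
  then show ?thesis using assms(2) by (simp add: velocity_variations_def velocity_space_def)
qed

text \<open>Where the velocity vanishes, the integrand vanishes and says nothing about the drag. On the
  open set where it does not, the derivative of the drag is continuous, and bumps multiplied by
  constants \<open>(h, r)\<close> show that this derivative vanishes in every direction.\<close>

lemma drag_variation_integral_vanishes_iff:
  fixes n :: "real ^ 'n \<Rightarrow> real ^ 'n"
  assumes dom: "regular_domain \<Omega> n" and bdy: "boundary_partition \<Omega> \<Gamma>v \<Gamma>p"
    and reg: "regular_drag \<Omega> \<alpha>"
    and v: "C1_on_closure \<Omega> v" and p: "C1_on_closure \<Omega> p"
  shows "(\<forall>\<delta>v\<in>velocity_variations \<Omega> n \<Gamma>v. \<forall>\<delta>p\<in>pressure_space \<Omega>.
           drag_variation_integral \<Omega> \<alpha> v p \<delta>v \<delta>p = 0) \<longleftrightarrow>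
     (\<forall>x\<in>\<Omega>. v x \<noteq> 0 \<longrightarrow> drag_dv \<alpha> x (v x) (p x) = 0 \<and> drag_dp \<alpha> x (v x) (p x) = 0)"
    (is "?L \<longleftrightarrow> ?R")
proof
  assume R: ?R
  have "drag_variation_integral \<Omega> \<alpha> v p \<delta>v \<delta>p = 0" for \<delta>v \<delta>p
  proof -
    have "drag_variation_integral \<Omega> \<alpha> v p \<delta>v \<delta>p = (LINT x:\<Omega>|lborel. 0)"
      unfolding drag_variation_integral_def
    proof (rule set_lebesgue_integral_cong)
      show "\<Omega> \<in> sets lborel" using dom by (simp add: regular_domain_def)
      show "\<forall>x. x \<in> \<Omega> \<longrightarrow> 1/2 * (drag_dv \<alpha> x (v x) (p x) \<bullet> \<delta>v x + drag_dp \<alpha> x (v x) (p x) * \<delta>p x)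
        * (v x \<bullet> v x) = 0"
        using R by (metis add_0 inner_zero_left mult_zero_left mult_zero_right)
    qed
    then show ?thesis by simp
  qed
  then show ?L by blast
next
  assume L: ?L
  have op: "open \<Omega>" using dom by (simp add: regular_domain_def)
  have \<Gamma>v: "\<Gamma>v \<subseteq> frontier \<Omega>" using bdy by (auto simp: boundary_partition_def)
  obtain A :: "(real ^ 'n) \<times> (real ^ 'n) \<times> real \<Rightarrow> ((real ^ 'n) \<times> real) \<Rightarrow>\<^sub>L real"
    where A: "\<And>x v p. x \<in> closure \<Omega> \<Longrightarrow> v \<noteq> 0 \<Longrightarrow>
           ((\<lambda>(w, q). \<alpha> x w q) has_derivative blinfun_apply (A (x, v, p))) (at (v, p))"
      and A_cont: "continuous_on (closure \<Omega> \<times> (- {0}) \<times> UNIV) A"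
      and "\<And>S. bounded S \<Longrightarrow> bounded (A ` (S \<inter> (closure \<Omega> \<times> (- {0}) \<times> UNIV)))"
    using that by (rule regular_dragE[OF reg])
  have cont: "continuous_on \<Omega> v" "continuous_on \<Omega> p"
    using v p closure_subset[of \<Omega>] by (auto dest!: C1_on_closure_continuous intro: continuous_on_subset)
  define U where "U = \<Omega> \<inter> v -` (- {0})"
  have U: "open U" "U \<subseteq> \<Omega>"
    unfolding U_def using cont(1) op by (auto intro!: continuous_open_preimage)
  have contU: "continuous_on U v" "continuous_on U p"
    using cont U(2) by (auto intro: continuous_on_subset)
  have AU: "continuous_on U (\<lambda>x. A (x, v x, p x))"
    by (rule continuous_on_compose2[OF A_cont])
       (use closure_subset[of \<Omega>] in \<open>auto intro!: continuous_intros contU[unfolded U_def] simp: U_def\<close>)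
  have AD: "blinfun_apply (A (x, v x, p x)) (h, r)
      = drag_dv \<alpha> x (v x) (p x) \<bullet> h + drag_dp \<alpha> x (v x) (p x) * r" if "x \<in> U" for x h r
  proof -
    have "x \<in> closure \<Omega>" "v x \<noteq> 0" using that closure_subset[of \<Omega>] by (auto simp: U_def)
    from drag_partials[where \<alpha> = \<alpha> and x = x and v = "v x" and p = "p x", OF A[OF this]]
    show ?thesis .
  qed
  have key: "blinfun_apply (A (x0, v x0, p x0)) (h, r) = 0" if x0: "x0 \<in> U" for x0 h r
  proof -
    define f where "f x = (drag_dv \<alpha> x (v x) (p x) \<bullet> h + drag_dp \<alpha> x (v x) (p x) * r) * (v x \<bullet> v x)" for x
    have "continuous_on U (\<lambda>x. blinfun_apply (A (x, v x, p x)) (h, r) * (v x \<bullet> v x))"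
      by (intro continuous_intros AU contU)
    then have "continuous_on U f"
      by (rule continuous_on_eq) (simp add: AD f_def)
    then have "f x0 = 0"
    proof (rule bump_integral_zero_imp_zero[OF U x0 _ op])
      fix s :: real assume s: "0 < s" "cball x0 s \<subseteq> U"
      have b: "C1_on_closure \<Omega> (bump x0 s)" by (rule C1_on_closure_bump)
      have "(\<lambda>x. bump x0 s x *\<^sub>R h) \<in> velocity_variations \<Omega> n \<Gamma>v"
      proof (rule interior_support_velocity_variation[OF op _ _ \<Gamma>v])
        show "bump x0 s x *\<^sub>R h = 0" if "x \<notin> \<Omega>" for x
          using bump_outside[of s x0 x] s U(2) that by (cases "x \<in> cball x0 s") auto
      qed (intro C1_on_closure_scaleR b C1_on_closure_const)
      moreover have "(\<lambda>x. bump x0 s x *\<^sub>R r) \<in> pressure_space \<Omega>"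
        unfolding pressure_space_def by (intro CollectI C1_on_closure_scaleR b C1_on_closure_const)
      ultimately have "0 = drag_variation_integral \<Omega> \<alpha> v p (\<lambda>x. bump x0 s x *\<^sub>R h) (\<lambda>x. bump x0 s x *\<^sub>R r)"
        using L by simp
      also have "\<dots> = (LINT x:\<Omega>|lborel. 1/2 * (bump x0 s x * f x))"
        unfolding drag_variation_integral_def f_def by (simp add: algebra_simps)
      also have "\<dots> = 1/2 * (LINT x:\<Omega>|lborel. bump x0 s x * f x)"
        by (rule set_integral_mult_right)
      finally show "(LINT x:\<Omega>|lborel. bump x0 s x * f x) = 0" by simp
    qed
    moreover have "v x0 \<noteq> 0" using x0 by (simp add: U_def)
    ultimately show ?thesis by (simp add: f_def AD[OF x0])
  qed
  show ?R
  proof (intro ballI impI)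
    fix x assume "x \<in> \<Omega>" "v x \<noteq> 0"
    then have x: "x \<in> U" by (simp add: U_def)
    have "drag_dv \<alpha> x (v x) (p x) \<bullet> drag_dv \<alpha> x (v x) (p x) = 0"
      using key[OF x, of "drag_dv \<alpha> x (v x) (p x)" 0] by (simp add: AD[OF x])
    moreover have "drag_dp \<alpha> x (v x) (p x) = 0"
      using key[OF x, of 0 1] by (simp add: AD[OF x])
    ultimately show "drag_dv \<alpha> x (v x) (p x) = 0 \<and> drag_dp \<alpha> x (v x) (p x) = 0" by simp
  qed
qed

lemma necessary_condition_iff:
  fixes n :: "real ^ 'n \<Rightarrow> real ^ 'n"
  assumes dom: "regular_domain \<Omega> n" and bdy: "boundary_partition \<Omega> \<Gamma>v \<Gamma>p"
    and reg: "regular_drag \<Omega> \<alpha>" and sol: "flow_solution \<Omega> n \<Gamma>v \<Gamma>p \<rho> b vn p\<^sub>0 \<alpha> v p"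
  shows "necessary_condition \<Omega> n \<Gamma>v \<Gamma>p \<rho> b p\<^sub>0 \<alpha> v p \<longleftrightarrow>
     (\<forall>x\<in>\<Omega>. v x \<noteq> 0 \<longrightarrow> drag_dv \<alpha> x (v x) (p x) = 0 \<and> drag_dp \<alpha> x (v x) (p x) = 0)"
proof -
  have "first_variation \<Omega> n \<Gamma>p \<rho> b p\<^sub>0 \<alpha> v p h r = drag_variation_integral \<Omega> \<alpha> v p h r"
    if "h \<in> velocity_variations \<Omega> n \<Gamma>v" "r \<in> pressure_space \<Omega>" for h r
    unfolding first_variation_def
    by (rule DERIV_imp_deriv) (rule lagrangian_derivative[OF dom bdy reg sol that])
  then have "necessary_condition \<Omega> n \<Gamma>v \<Gamma>p \<rho> b p\<^sub>0 \<alpha> v p \<longleftrightarrow>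
     (\<forall>\<delta>v\<in>velocity_variations \<Omega> n \<Gamma>v. \<forall>\<delta>p\<in>pressure_space \<Omega>.
           drag_variation_integral \<Omega> \<alpha> v p \<delta>v \<delta>p = 0)"
    unfolding necessary_condition_def by simp
  also have "\<dots> \<longleftrightarrow> (\<forall>x\<in>\<Omega>. v x \<noteq> 0 \<longrightarrow> drag_dv \<alpha> x (v x) (p x) = 0 \<and> drag_dp \<alpha> x (v x) (p x) = 0)"
    using sol by (intro drag_variation_integral_vanishes_iff[OF dom bdy reg]) (auto simp: flow_solution_def)
  finally show ?thesis .
qed

section \<open>Drags that satisfy the necessary condition for all data\<close>

text \<open>Every pair of constant fields solves the flow equations with the body force that balances
  its drag. So the necessary condition can be tested at any prescribed values of velocity and
  pressure.\<close>

lemma constant_flow_solution: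
  assumes "\<rho> > 0"
  shows "flow_solution \<Omega> n \<Gamma>v \<Gamma>p \<rho> (\<lambda>x. (1 / \<rho>) *\<^sub>R (\<alpha> x w q *\<^sub>R w)) (\<lambda>x. w \<bullet> n x) (\<lambda>_. q) \<alpha>
     (\<lambda>_. w) (\<lambda>_. q)"
  using assms
  by (simp add: flow_solution_def C1_on_closure_const gradient_def vec_eq_iff
      divergence_has_derivative[OF has_derivative_const])

text \<open>Since the drag may fail to be differentiable at vanishing velocity, all values are compared
  with the one at zero velocity along rays, which works in dimension one as well, where
  nonvanishing velocities do not form a connected set.\<close>

lemma drag_constant:
  fixes \<alpha> :: "real ^ 'n \<Rightarrow> real ^ 'n \<Rightarrow> real \<Rightarrow> real"
  assumes reg: "regular_drag \<Omega> \<alpha>" and x: "x \<in> closure \<Omega>"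
    and zero: "\<And>w q. w \<noteq> 0 \<Longrightarrow> drag_dv \<alpha> x w q = 0 \<and> drag_dp \<alpha> x w q = 0"
  shows "\<alpha> x w q = \<alpha> x w' q'"
proof -
  obtain A :: "(real ^ 'n) \<times> (real ^ 'n) \<times> real \<Rightarrow> ((real ^ 'n) \<times> real) \<Rightarrow>\<^sub>L real"
    where A: "\<And>x v p. x \<in> closure \<Omega> \<Longrightarrow> v \<noteq> 0 \<Longrightarrow>
           ((\<lambda>(w, q). \<alpha> x w q) has_derivative blinfun_apply (A (x, v, p))) (at (v, p))"
      and "continuous_on (closure \<Omega> \<times> (- {0}) \<times> UNIV) A"
      and "\<And>S. bounded S \<Longrightarrow> bounded (A ` (S \<inter> (closure \<Omega> \<times> (- {0}) \<times> UNIV)))"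
    using that by (rule regular_dragE[OF reg])
  have der: "((\<lambda>(w, q). \<alpha> x w q) has_derivative (\<lambda>_. 0)) (at (w, q))" if "w \<noteq> 0" for w q
  proof -
    have "blinfun_apply (A (x, w, q)) z = 0" for z
      using drag_partials[where \<alpha> = \<alpha> and x = x and v = w and p = q, OF A[OF x that], of "fst z" "snd z"]
        zero[OF that, of q] by simp
    then have "blinfun_apply (A (x, w, q)) = (\<lambda>_. 0)" by (rule ext)
    with A[OF x that, of q] show ?thesis by simp
  qed
  have line: "((\<lambda>t. \<alpha> x (u + t *\<^sub>R h) (q + t * r)) has_real_derivative 0) (at t)"
    if "u + t *\<^sub>R h \<noteq> 0" for u h :: "real ^ 'n" and q r t :: real
  proof -
    have "((\<lambda>t. (u + t *\<^sub>R h, q + t * r)) has_derivative (\<lambda>t. (t *\<^sub>R h, t * r))) (at t)"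
      by (auto intro!: derivative_eq_intros)
    from has_derivative_compose[OF this der[OF that]]
    have d: "((\<lambda>t. \<alpha> x (u + t *\<^sub>R h) (q + t * r)) has_derivative (\<lambda>_. 0)) (at t)" by simp
    have "(*) 0 = (\<lambda>_. 0 :: real)" by (rule ext) simp
    then show ?thesis using d by (simp only: has_field_derivative_def)
  qed
  have pres: "\<alpha> x w q = \<alpha> x w 0" if "w \<noteq> 0" for w q
  proof -
    have "\<forall>t. ((\<lambda>t. \<alpha> x (w + t *\<^sub>R 0) (0 + t * 1)) has_real_derivative 0) (at t)"
      using that by (intro allI line) simp
    from DERIV_isconst_all[OF this, of q 0] show ?thesis by simp
  qed
  have ray: "\<alpha> x w q = \<alpha> x 0 q" if "w \<noteq> 0" for w q
  proof -
    let ?f = "\<lambda>t. \<alpha> x (0 + t *\<^sub>R w) (q + t * 0)"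
    have c: "continuous_on (closure \<Omega> \<times> UNIV) (\<lambda>(x, v, p). \<alpha> x v p)"
      using reg by (simp add: regular_drag_def)
    have "continuous_on {0..1} (\<lambda>t. (\<lambda>(x, v, p). \<alpha> x v p) (x, 0 + t *\<^sub>R w, q + t * 0))"
      by (rule continuous_on_compose2[OF c]) (use x in \<open>auto intro!: continuous_intros\<close>)
    then have "continuous_on {0..1} ?f" by simp
    moreover have "(?f has_real_derivative 0) (at t)" if "0 < t" "t < 1" for t
      using that \<open>w \<noteq> 0\<close> by (intro line) simp
    ultimately have "?f 1 = ?f 0"
      using DERIV_isconst_end[of 0 1 ?f] by auto
    then show ?thesis by simp
  qed
  define e :: "real ^ 'n" where "e = axis undefined 1"
  have e: "e \<noteq> 0" by (simp add: e_def axis_eq_0_iff)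
  have eq: "\<alpha> x w q = \<alpha> x e 0" for w q
    using ray[of w q] ray[OF e, of q] pres[OF e, of q] by (cases "w = 0") simp_all
  show ?thesis unfolding eq[of w q] eq[of w' q'] ..
qed

lemma necessary_condition_for_all_data_iff:
  fixes n :: "real ^ 'n \<Rightarrow> real ^ 'n"
  assumes dom: "regular_domain \<Omega> n" and bdy: "boundary_partition \<Omega> \<Gamma>v \<Gamma>p" and \<rho>: "\<rho> > 0"
    and reg: "regular_drag \<Omega> \<alpha>"
  shows "(\<forall>b vn p\<^sub>0 v p. flow_solution \<Omega> n \<Gamma>v \<Gamma>p \<rho> b vn p\<^sub>0 \<alpha> v p \<longrightarrow>
           necessary_condition \<Omega> n \<Gamma>v \<Gamma>p \<rho> b p\<^sub>0 \<alpha> v p) \<longleftrightarrow>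
        (\<forall>x\<in>\<Omega>. \<forall>w q w' q'. \<alpha> x w q = \<alpha> x w' q')"
    (is "?L \<longleftrightarrow> ?R")
proof
  assume L: ?L
  have "drag_dv \<alpha> x w q = 0 \<and> drag_dp \<alpha> x w q = 0" if "x \<in> \<Omega>" "w \<noteq> 0" for x w q
  proof -
    note sol = constant_flow_solution[OF \<rho>, of \<Omega> n \<Gamma>v \<Gamma>p \<alpha> w q]
    have "necessary_condition \<Omega> n \<Gamma>v \<Gamma>p \<rho> (\<lambda>x. (1 / \<rho>) *\<^sub>R (\<alpha> x w q *\<^sub>R w)) (\<lambda>_. q) \<alpha> (\<lambda>_. w) (\<lambda>_. q)"
      by (rule L[rule_format, OF sol])
    with necessary_condition_iff[OF dom bdy reg sol] that show ?thesis by simp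
  qed
  then show ?R
    using closure_subset[of \<Omega>] by (intro ballI allI drag_constant[OF reg]) auto
next
  assume R: ?R
  have "drag_dv \<alpha> x w q = 0 \<and> drag_dp \<alpha> x w q = 0" if "x \<in> \<Omega>" for x w q
  proof -
    have v: "(\<lambda>w. \<alpha> x w q) = (\<lambda>_. \<alpha> x 0 0)" by (rule ext) (rule R[rule_format, OF that])
    have p: "(\<lambda>q. \<alpha> x w q) = (\<lambda>_. \<alpha> x 0 0)" by (rule ext) (rule R[rule_format, OF that])
    show ?thesis
      unfolding drag_dv_def drag_dp_def v p by (simp add: gradient_def vec_eq_iff)
  qed
  then show ?L
    by (intro allI impI, subst necessary_condition_iff[OF dom bdy reg]) auto
qed

section \<open>The Darcy-Forchheimer and Barus drags\<close>

text \<open>Here the derivative is represented by a gradient, which avoids operator-valued maps.\<close>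

lemma regular_dragI:
  fixes \<alpha> :: "real ^ 'n \<Rightarrow> real ^ 'n \<Rightarrow> real \<Rightarrow> real"
    and G :: "(real ^ 'n) \<times> (real ^ 'n) \<times> real \<Rightarrow> (real ^ 'n) \<times> real"
  assumes "continuous_on (closure \<Omega> \<times> UNIV) (\<lambda>(x, v, p). \<alpha> x v p)"
    and "\<And>x v p. x \<in> closure \<Omega> \<Longrightarrow> v \<noteq> 0 \<Longrightarrow>
      ((\<lambda>(w, q). \<alpha> x w q) has_derivative (\<lambda>h. G (x, v, p) \<bullet> h)) (at (v, p))"
    and "continuous_on (closure \<Omega> \<times> (- {0}) \<times> UNIV) G"
    and "\<And>S. bounded S \<Longrightarrow> bounded (G ` (S \<inter> (closure \<Omega> \<times> (- {0}) \<times> UNIV)))"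
  shows "regular_drag \<Omega> \<alpha>"
  unfolding regular_drag_def
proof (intro conjI exI[of _ "\<lambda>z. blinfun_inner_right (G z)"] ballI allI impI)
  fix S :: "((real ^ 'n) \<times> (real ^ 'n) \<times> real) set" assume "bounded S"
  from bounded_linear_image[OF assms(4)[OF this] bounded_linear_blinfun_inner_right]
  show "bounded ((\<lambda>z. blinfun_inner_right (G z)) ` (S \<inter> (closure \<Omega> \<times> (- {0}) \<times> UNIV)))"
    by (simp add: image_image)
qed (use assms in \<open>auto intro!: bounded_linear.continuous_on[OF bounded_linear_blinfun_inner_right]\<close>)

lemma reciprocal_permeability_bounded:
  fixes k :: "real ^ 'n \<Rightarrow> real"
  assumes "bounded \<Omega>" "continuous_on (closure \<Omega>) k" "\<And>x. x \<in> closure \<Omega> \<Longrightarrow> k x > 0"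
  obtains K where "K > 0" "\<And>x. x \<in> closure \<Omega> \<Longrightarrow> 1 / k x \<le> K"
proof -
  have "continuous_on (closure \<Omega>) (\<lambda>x. 1 / k x)"
    using assms by (intro continuous_intros) force+
  then have "bounded ((\<lambda>x. 1 / k x) ` closure \<Omega>)"
    using assms(1) by (intro compact_imp_bounded compact_continuous_image) auto
  then obtain K where K: "K > 0" "\<And>x. x \<in> closure \<Omega> \<Longrightarrow> \<bar>1 / k x\<bar> \<le> K"
    unfolding bounded_pos by auto
  show ?thesis
    by (rule that[OF K(1)]) (metis K(2) abs_le_D1)
qed

lemma
  fixes k :: "real ^ 'n \<Rightarrow> real"
  assumes bd: "bounded \<Omega>" and k: "continuous_on (closure \<Omega>) k" "\<And>x. x \<in> closure \<Omega> \<Longrightarrow> k x > 0"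
  shows regular_drag_darcy_forchheimer: "regular_drag \<Omega> (darcy_forchheimer \<mu> \<beta> k)"
    and drag_dv_darcy_forchheimer: "x \<in> closure \<Omega> \<Longrightarrow> w \<noteq> 0 \<Longrightarrow>
      drag_dv (darcy_forchheimer \<mu> \<beta> k) x w q \<bullet> w = \<mu> / k x * \<beta> * norm w"
proof -
  define G :: "(real ^ 'n) \<times> (real ^ 'n) \<times> real \<Rightarrow> (real ^ 'n) \<times> real"
    where "G = (\<lambda>(x, v, p). ((\<mu> / k x * \<beta> / norm v) *\<^sub>R v, 0))"
  have k0: "k x \<noteq> 0" if "x \<in> closure \<Omega>" for x using k(2)[OF that] by simp
  have der: "((\<lambda>(w, q). darcy_forchheimer \<mu> \<beta> k x w q) has_derivative (\<lambda>h. G (x, v, p) \<bullet> h)) (at (v, p))"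
    if "v \<noteq> 0" for x v p
  proof -
    have "((\<lambda>z. norm (fst z)) has_derivative (\<lambda>h. fst h \<bullet> sgn v)) (at (v, p))"
    proof -
      have "(norm has_derivative (\<lambda>h. h \<bullet> sgn v)) (at (fst (v, p)))"
        using has_derivative_norm[OF that] by simp
      from has_derivative_compose[OF has_derivative_fst[OF has_derivative_ident] this]
      show ?thesis by simp
    qed
    then have "((\<lambda>z. m * (1 + \<beta> * norm (fst z))) has_derivative
        (\<lambda>h. m * (\<beta> * (fst h \<bullet> sgn v)))) (at (v, p))" for m
      by (auto intro!: derivative_eq_intros)
    from this[of "\<mu> / k x"]
    have "((\<lambda>z. \<mu> / k x * (1 + \<beta> * norm (fst z))) has_derivative
        (\<lambda>h. \<mu> / k x * (\<beta> * (fst h \<bullet> sgn v)))) (at (v, p))" .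
    moreover have "(\<lambda>h. \<mu> / k x * (\<beta> * (fst h \<bullet> sgn v))) = (\<lambda>h. G (x, v, p) \<bullet> h)"
      by (auto simp: G_def sgn_div_norm inner_commute fun_eq_iff divide_simps inner_prod_def)
    ultimately show ?thesis
      by (simp add: darcy_forchheimer_def case_prod_beta')
  qed
  have kc: "continuous_on (closure \<Omega> \<times> S) (\<lambda>z. k (fst z))" for S :: "((real ^ 'n) \<times> real) set"
    by (rule continuous_on_compose2[OF k(1)]) (auto intro!: continuous_intros)
  obtain K where K: "K > 0" "\<And>x. x \<in> closure \<Omega> \<Longrightarrow> 1 / k x \<le> K"
    using reciprocal_permeability_bounded[OF bd k] by blast
  show "regular_drag \<Omega> (darcy_forchheimer \<mu> \<beta> k)"
  proof (rule regular_dragI)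
    show "continuous_on (closure \<Omega> \<times> UNIV) (\<lambda>(x, v, p). darcy_forchheimer \<mu> \<beta> k x v p)"
      unfolding case_prod_beta' darcy_forchheimer_def
      by (intro continuous_intros kc) (auto simp: k0)
    show "continuous_on (closure \<Omega> \<times> (- {0}) \<times> UNIV) G"
      unfolding G_def case_prod_beta'
      by (intro continuous_intros kc) (auto simp: k0)
    show "bounded (G ` (S \<inter> (closure \<Omega> \<times> (- {0}) \<times> UNIV)))" for S
      unfolding bounded_iff
    proof (intro exI[of _ "\<bar>\<mu> * \<beta>\<bar> * K"] ballI)
      fix y assume "y \<in> G ` (S \<inter> (closure \<Omega> \<times> (- {0}) \<times> UNIV))"
      then obtain x v p where x: "x \<in> closure \<Omega>" "v \<noteq> 0" "y = G (x, v, p)" by auto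
      have "norm y = \<bar>\<mu> * \<beta>\<bar> * (1 / k x)"
        using x k(2)[OF x(1)] by (simp add: G_def norm_Pair abs_mult)
      also have "\<dots> \<le> \<bar>\<mu> * \<beta>\<bar> * K" using K(2)[OF x(1)] by (intro mult_left_mono) auto
      finally show "norm y \<le> \<bar>\<mu> * \<beta>\<bar> * K" .
    qed
  qed (rule der)
  show "drag_dv (darcy_forchheimer \<mu> \<beta> k) x w q \<bullet> w = \<mu> / k x * \<beta> * norm w" if "w \<noteq> 0"
    using drag_partials[where \<alpha> = "darcy_forchheimer \<mu> \<beta> k" and x = x and v = w and p = q, OF der[OF that], of w 0] that
    by (simp add: G_def dot_square_norm power2_eq_square)
qed

lemma
  fixes k :: "real ^ 'n \<Rightarrow> real"
  assumes bd: "bounded \<Omega>" and k: "continuous_on (closure \<Omega>) k" "\<And>x. x \<in> closure \<Omega> \<Longrightarrow> k x > 0"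
  shows regular_drag_barus: "regular_drag \<Omega> (barus \<mu> \<beta> k)"
    and drag_dp_barus: "drag_dp (barus \<mu> \<beta> k) x w q = \<mu> / k x * \<beta> * exp (\<beta> * q)"
proof -
  define G :: "(real ^ 'n) \<times> (real ^ 'n) \<times> real \<Rightarrow> (real ^ 'n) \<times> real"
    where "G = (\<lambda>(x, v, p). (0, \<mu> / k x * \<beta> * exp (\<beta> * p)))"
  have k0: "k x \<noteq> 0" if "x \<in> closure \<Omega>" for x using k(2)[OF that] by simp
  have der: "((\<lambda>(w, q). barus \<mu> \<beta> k x w q) has_derivative (\<lambda>h. G (x, v, p) \<bullet> h)) (at (v, p))" for x v p
  proof -
    have "((\<lambda>z. m * exp (\<beta> * snd z)) has_derivative
        (\<lambda>h. m * (exp (\<beta> * p) * (\<beta> * snd h)))) (at (v, p))" for m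
      by (auto intro!: derivative_eq_intros)
    from this[of "\<mu> / k x"]
    have "((\<lambda>z. \<mu> / k x * exp (\<beta> * snd z)) has_derivative
        (\<lambda>h. \<mu> / k x * (exp (\<beta> * p) * (\<beta> * snd h)))) (at (v, p))" .
    moreover have "(\<lambda>h. \<mu> / k x * (exp (\<beta> * p) * (\<beta> * snd h))) = (\<lambda>h. G (x, v, p) \<bullet> h)"
      by (auto simp: G_def fun_eq_iff inner_prod_def)
    ultimately show ?thesis
      by (simp add: barus_def case_prod_beta')
  qed
  have kc: "continuous_on (closure \<Omega> \<times> S) (\<lambda>z. k (fst z))" for S :: "((real ^ 'n) \<times> real) set"
    by (rule continuous_on_compose2[OF k(1)]) (auto intro!: continuous_intros)
  obtain K where K: "K > 0" "\<And>x. x \<in> closure \<Omega> \<Longrightarrow> 1 / k x \<le> K"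
    using reciprocal_permeability_bounded[OF bd k] by blast
  show "regular_drag \<Omega> (barus \<mu> \<beta> k)"
  proof (rule regular_dragI)
    show "continuous_on (closure \<Omega> \<times> UNIV) (\<lambda>(x, v, p). barus \<mu> \<beta> k x v p)"
      unfolding case_prod_beta' barus_def
      by (intro continuous_intros kc) (auto simp: k0)
    show "continuous_on (closure \<Omega> \<times> (- {0}) \<times> UNIV) G"
      unfolding G_def case_prod_beta'
      by (intro continuous_intros kc) (auto simp: k0)
    fix S :: "((real ^ 'n) \<times> (real ^ 'n) \<times> real) set" assume "bounded S"
    then obtain B where B: "\<And>z. z \<in> S \<Longrightarrow> norm z \<le> B" by (auto simp: bounded_iff)
    show "bounded (G ` (S \<inter> (closure \<Omega> \<times> (- {0}) \<times> UNIV)))"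
      unfolding bounded_iff
    proof (intro exI[of _ "\<bar>\<mu> * \<beta>\<bar> * (K * exp (\<bar>\<beta>\<bar> * B))"] ballI)
      fix y assume "y \<in> G ` (S \<inter> (closure \<Omega> \<times> (- {0}) \<times> UNIV))"
      then obtain x v p where x: "x \<in> closure \<Omega>" "(x, v, p) \<in> S" "y = G (x, v, p)" by auto
      have "norm p \<le> B"
        using B[OF x(2)] norm_snd_le[of "(v, p)" x] norm_snd_le[of p v] by linarith
      then have "\<bar>\<beta> * p\<bar> \<le> \<bar>\<beta>\<bar> * B"
        unfolding abs_mult by (intro mult_left_mono) simp_all
      then have "\<beta> * p \<le> \<bar>\<beta>\<bar> * B" by (rule abs_le_D1)
      then have le: "1 / k x * exp (\<beta> * p) \<le> K * exp (\<bar>\<beta>\<bar> * B)"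
        using K(1) K(2)[OF x(1)] by (intro mult_mono) auto
      have "norm y = \<bar>\<mu> * \<beta>\<bar> * (1 / k x * exp (\<beta> * p))"
        using x k(2)[OF x(1)] by (simp add: G_def norm_Pair abs_mult)
      also have "\<dots> \<le> \<bar>\<mu> * \<beta>\<bar> * (K * exp (\<bar>\<beta>\<bar> * B))"
        using le by (rule mult_left_mono) simp
      finally show "norm y \<le> \<bar>\<mu> * \<beta>\<bar> * (K * exp (\<bar>\<beta>\<bar> * B))" .
    qed
  qed (rule der)
  show "drag_dp (barus \<mu> \<beta> k) x w q = \<mu> / k x * \<beta> * exp (\<beta> * q)"
    using drag_partials[where \<alpha> = "barus \<mu> \<beta> k" and x = x and v = w and p = q, OF der, of 0 1]
    by (simp add: G_def)
qed

section \<open>Competitors of smaller power\<close>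

text \<open>Up to a constant factor, this is the rotated gradient \<open>\<partial>\<^sub>j \<phi> e\<^sub>i - \<partial>\<^sub>i \<phi> e\<^sub>j\<close> of the compactly
  supported stream function \<open>\<phi> = (max 0 (s\<^sup>2 - |x - c|\<^sup>2))\<^sup>3\<close>.\<close>

definition swirl :: "'n \<Rightarrow> 'n \<Rightarrow> real ^ 'n \<Rightarrow> real \<Rightarrow> real ^ 'n \<Rightarrow> real ^ 'n" where
  "swirl i j c s x = bump c s x *\<^sub>R (((x - c) $ j) *\<^sub>R axis i 1 - ((x - c) $ i) *\<^sub>R axis j 1)"

lemma rotation_has_derivative:
  fixes i j :: "'n::finite"
  shows "((\<lambda>x. ((x - c) $ j) *\<^sub>R axis i 1 - ((x - c) $ i) *\<^sub>R axis j 1)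
     has_derivative (\<lambda>h. (h $ j) *\<^sub>R axis i 1 - (h $ i) *\<^sub>R (axis j 1 :: real ^ 'n))) (at x)"
  by (auto intro!: derivative_eq_intros bounded_linear.has_derivative[OF bounded_linear_vec_nth])

lemma C1_on_closure_swirl:
  fixes i j :: "'n::finite"
  shows "C1_on_closure \<Omega> (swirl i j c s)"
  unfolding swirl_def[abs_def]
proof (intro C1_on_closure_scaleR C1_on_closure_bump
    C1_on_closureI[where f' = "\<lambda>x h. (h $ j) *\<^sub>R axis i 1 - (h $ i) *\<^sub>R (axis j 1 :: real ^ 'n)"])
  show "bounded_linear (\<lambda>h. (h $ j) *\<^sub>R axis i 1 - (h $ i) *\<^sub>R (axis j 1 :: real ^ 'n))"
    using rotation_has_derivative by (rule has_derivative_bounded_linear)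
  show "continuous_on (closure \<Omega>) (\<lambda>x. ((x - c) $ j) *\<^sub>R axis i 1 - ((x - c) $ i) *\<^sub>R (axis j 1 :: real ^ 'n))"
    by (intro continuous_intros)
qed (rule continuous_on_const rotation_has_derivative)+

text \<open>The rotation field is divergence free, and it stays so after multiplication by the radial
  factor because the rotation field is tangential to spheres.\<close>

lemma divergence_swirl:
  fixes i j :: "'n::finite"
  assumes "i \<noteq> j"
  shows "divergence (swirl i j c s) x = 0"
proof -
  let ?J = "\<lambda>y. (y $ j) *\<^sub>R axis i 1 - (y $ i) *\<^sub>R (axis j 1 :: real ^ 'n)"
  have "divergence (\<lambda>x. ?J (x - c)) x = (\<Sum>k\<in>UNIV. ?J (axis k 1) $ k)"
    by (rule divergence_has_derivative[OF rotation_has_derivative])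
  also have "\<dots> = 0"
    by (intro sum.neutral ballI) (use assms in \<open>simp add: axis_def\<close>)
  finally have "divergence (\<lambda>x. ?J (x - c)) x = 0" .
  moreover have "?J (x - c) \<bullet> gradient (bump c s) x = bump_deriv c s x (?J (x - c))"
    by (subst inner_commute) (rule gradient_has_derivative[OF bump_has_derivative])
  moreover have "(x - c) \<bullet> ?J (x - c) = 0"
    by (simp add: inner_diff_right inner_axis)
  ultimately show ?thesis
    using divergence_scaleR_field[OF bump_has_derivative[where c = c and s = s and x = x]
        rotation_has_derivative[where c = c and i = i and j = j and x = x]]
    by (simp add: swirl_def[abs_def] bump_deriv_def)
qed

lemma swirl_outside: "0 < s \<Longrightarrow> x \<notin> ball c s \<Longrightarrow> swirl i j c s x = 0"
  by (simp add: swirl_def bump_outside)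

lemma swirl_nonzero:
  assumes "i \<noteq> j" "x \<in> ball c s" "x $ j \<noteq> c $ j"
  shows "swirl i j c s x \<noteq> 0"
proof
  assume "swirl i j c s x = 0"
  then have "swirl i j c s x $ i = 0" by simp
  then show False using assms bump_pos[of c x s] by (simp add: swirl_def axis_def)
qed

lemma swirl_nonzero_open:
  assumes "i \<noteq> j" "s > 0"
  obtains B where "open B" "B \<noteq> {}" "B \<subseteq> ball c s" "\<And>x. x \<in> B \<Longrightarrow> swirl i j c s x \<noteq> 0"
proof (rule that[of "ball c s \<inter> {x. c $ j < x $ j}"])
  have "open {x. c $ j < x $ j}" by (intro open_Collect_less continuous_intros)
  then show "open (ball c s \<inter> {x. c $ j < x $ j})" by (intro open_Int open_ball)
  have "c + (s / 2) *\<^sub>R axis j 1 \<in> ball c s \<inter> {x. c $ j < x $ j}"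
    using assms by (simp add: dist_norm)
  then show "ball c s \<inter> {x. c $ j < x $ j} \<noteq> {}" by blast
qed (use swirl_nonzero[OF assms(1)] in auto)

text \<open>A compactly supported divergence-free velocity \<open>\<psi>\<close> is compared with its own multiples
  \<open>t \<psi>\<close>. With \<open>A\<close> and \<open>C\<close> the integrals of \<open>\<mu>/k |\<psi>|\<^sup>2\<close> and \<open>\<mu>/k |\<psi>|\<^sup>3\<close>, their power for
  \<open>t > 0\<close> is \<open>A (t\<^sup>2/2 - t) + \<beta> C (t\<^sup>3/2 - t)\<close>. Its derivative \<open>\<beta> C / 2\<close> at \<open>t = 1\<close> does not
  vanish, so that some multiples close to \<open>\<psi>\<close> need less power than \<open>\<psi>\<close>.\<close>

lemma darcy_forchheimer_no_minimum_power:
  fixes n :: "real ^ 'n \<Rightarrow> real ^ 'n"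
  assumes dom: "regular_domain \<Omega> n" and bdy: "boundary_partition \<Omega> \<Gamma>v \<Gamma>p" and \<rho>: "\<rho> > 0"
    and \<mu>: "\<mu> > 0" and \<beta>: "\<beta> \<noteq> 0"
    and k: "continuous_on (closure \<Omega>) k" "\<And>x. x \<in> closure \<Omega> \<Longrightarrow> k x > 0"
    and dim: "2 \<le> CARD('n)"
  shows "\<not> minimum_power_theorem \<Omega> n \<Gamma>v \<Gamma>p \<rho> (darcy_forchheimer \<mu> \<beta> k)"
proof
  assume min: "minimum_power_theorem \<Omega> n \<Gamma>v \<Gamma>p \<rho> (darcy_forchheimer \<mu> \<beta> k)"
  have op: "open \<Omega>" and bd: "bounded \<Omega>" and ne: "\<Omega> \<noteq> {}" and \<Omega>: "\<Omega> \<in> sets lborel"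
    using dom by (auto simp: regular_domain_def)
  have cl: "\<Omega> \<subseteq> closure \<Omega>" by (rule closure_subset)
  have fr: "\<Gamma>v \<subseteq> frontier \<Omega>" using bdy by (auto simp: boundary_partition_def)
  obtain i j :: 'n where ij: "i \<noteq> j"
  proof -
    have "\<not> card (UNIV :: 'n set) \<le> Suc 0" using dim by simp
    then show ?thesis using that by (auto simp: card_le_Suc0_iff_eq)
  qed
  obtain x0 s where s: "s > 0" "ball x0 s \<subseteq> \<Omega>" 
  proof -
    obtain x0 where "x0 \<in> \<Omega>" using ne by blast
    with op show ?thesis using that by (meson openE)
  qed
  define \<psi> where "\<psi> = swirl i j x0 s"
  let ?\<alpha> = "darcy_forchheimer \<mu> \<beta> k"
  have \<psi>C: "C1_on_closure \<Omega> \<psi>" unfolding \<psi>_def by (rule C1_on_closure_swirl)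
  have \<psi>c: "continuous_on (closure \<Omega>) \<psi>" using \<psi>C by (rule C1_on_closure_continuous)
  have \<psi>0: "\<psi> x = 0" if "x \<notin> \<Omega>" for x
    unfolding \<psi>_def using s that by (intro swirl_outside) auto
  have \<psi>v: "\<psi> x = 0" if "x \<in> \<Gamma>v" for x
    using that fr op by (intro \<psi>0) (auto simp: frontier_def interior_open)
  define b where "b x = (1 / \<rho>) *\<^sub>R (?\<alpha> x (\<psi> x) 0 *\<^sub>R \<psi> x)" for x
  have sol: "flow_solution \<Omega> n \<Gamma>v \<Gamma>p \<rho> b (\<lambda>x. \<psi> x \<bullet> n x) (\<lambda>_. 0) ?\<alpha> \<psi> (\<lambda>_. 0)"
    using \<rho> \<psi>C unfolding flow_solution_def
    by (simp add: b_def C1_on_closure_const gradient_def vec_eq_iff divergence_swirl[OF ij] \<psi>_def)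
  define m where "m x = \<mu> / k x" for x
  have mc: "continuous_on (closure \<Omega>) m"
    unfolding m_def using k(2) by (intro continuous_intros k(1)) force
  have m: "m x > 0" if "x \<in> \<Omega>" for x using \<mu> k(2)[of x] that cl by (auto simp: m_def)
  note I = set_integrable_continuous_on_closure[OF op bd]
  define A where "A = (LINT x:\<Omega>|lborel. m x * (norm (\<psi> x))\<^sup>2)"
  define C where "C = (LINT x:\<Omega>|lborel. m x * norm (\<psi> x) ^ 3)"
  have C_pos: "C > 0"
  proof -
    obtain B where B: "open B" "B \<noteq> {}" "B \<subseteq> ball x0 s" "\<And>x. x \<in> B \<Longrightarrow> \<psi> x \<noteq> 0"
      using that unfolding \<psi>_def by (rule swirl_nonzero_open[OF ij s(1)])
    have B\<Omega>: "B \<subseteq> \<Omega>" using B(3) s(2) by blast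
    show ?thesis
      unfolding C_def
    proof (rule set_integral_pos[OF _ _ B(1,2) B\<Omega>])
      show "set_integrable lborel \<Omega> (\<lambda>x. m x * norm (\<psi> x) ^ 3)"
        by (intro I continuous_intros mc \<psi>c)
      show "0 \<le> m x * norm (\<psi> x) ^ 3" if "x \<in> \<Omega>" for x using m[OF that] by simp
      show "0 < m x * norm (\<psi> x) ^ 3" if "x \<in> B" for x using m[of x] B(4)[OF that] B\<Omega> that by auto
    qed
  qed
  define P where "P t = A * (t\<^sup>2 / 2 - t) + \<beta> * C * (t ^ 3 / 2 - t)" for t
  have power: "power_functional \<Omega> n \<Gamma>p \<rho> b (\<lambda>_. 0) ?\<alpha> (\<lambda>x. t *\<^sub>R \<psi> x) (\<lambda>_. 0) = P t"
    if "t > 0" for t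
  proof -
    have "(LINT x:\<Omega>|lborel. 1/2 * ?\<alpha> x (t *\<^sub>R \<psi> x) 0 * ((t *\<^sub>R \<psi> x) \<bullet> (t *\<^sub>R \<psi> x)))
       = (LINT x:\<Omega>|lborel. t\<^sup>2 / 2 * (m x * (norm (\<psi> x))\<^sup>2) + \<beta> * t ^ 3 / 2 * (m x * norm (\<psi> x) ^ 3))"
      using that by (intro set_lebesgue_integral_cong[OF \<Omega>])
        (auto simp: darcy_forchheimer_def m_def dot_square_norm power2_eq_square power3_eq_cube algebra_simps)
    also have "\<dots> = t\<^sup>2 / 2 * A + \<beta> * t ^ 3 / 2 * C"
      unfolding A_def C_def
      by (subst set_integral_add(2)) (auto intro!: set_integrable_mult_right I continuous_intros mc \<psi>c)
    finally have 1: "(LINT x:\<Omega>|lborel. 1/2 * ?\<alpha> x (t *\<^sub>R \<psi> x) 0 * ((t *\<^sub>R \<psi> x) \<bullet> (t *\<^sub>R \<psi> x)))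
       = t\<^sup>2 / 2 * A + \<beta> * t ^ 3 / 2 * C" .
    have "(LINT x:\<Omega>|lborel. (t *\<^sub>R \<psi> x) \<bullet> (\<rho> *\<^sub>R b x))
       = (LINT x:\<Omega>|lborel. t * (m x * (norm (\<psi> x))\<^sup>2) + t * \<beta> * (m x * norm (\<psi> x) ^ 3))"
      using \<rho> by (intro set_lebesgue_integral_cong[OF \<Omega>])
        (auto simp: b_def darcy_forchheimer_def m_def dot_square_norm power2_eq_square power3_eq_cube algebra_simps)
    also have "\<dots> = t * A + t * \<beta> * C"
      unfolding A_def C_def
      by (subst set_integral_add(2)) (auto intro!: set_integrable_mult_right I continuous_intros mc \<psi>c)
    finally have 2: "(LINT x:\<Omega>|lborel. (t *\<^sub>R \<psi> x) \<bullet> (\<rho> *\<^sub>R b x)) = t * A + t * \<beta> * C" .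
    show ?thesis
      unfolding power_functional_def 1 2 P_def by (simp add: algebra_simps)
  qed
  have P_min: "P 1 \<le> P t" if "t > 0" for t
  proof -
    have adm: "(\<lambda>x. t *\<^sub>R \<psi> x) \<in> kinematically_admissible \<Omega> n \<Gamma>v (\<lambda>x. \<psi> x \<bullet> n x)"
    proof -
      have "divergence (\<lambda>x. 0 + t *\<^sub>R \<psi> x) x = 0" if x: "x \<in> \<Omega>" for x
      proof -
        obtain D where D: "(\<psi> has_derivative D) (at x)" using C1_on_closure_has_derivative[OF \<psi>C x] by blast
        have "divergence \<psi> x = 0" unfolding \<psi>_def by (rule divergence_swirl[OF ij])
        then show ?thesis
          using divergence_add_scaleR[OF has_derivative_const D, of 0 t]
          by (simp add: divergence_has_derivative[OF has_derivative_const])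
      qed
      then show ?thesis
        using \<psi>v by (simp add: kinematically_admissible_def velocity_space_def
            C1_on_closure_scaleR C1_on_closure_const \<psi>C)
    qed
    have zero: "(\<lambda>_. 0) \<in> pressure_space \<Omega>"
      by (simp add: pressure_space_def C1_on_closure_const)
    have "power_functional \<Omega> n \<Gamma>p \<rho> b (\<lambda>_. 0) ?\<alpha> \<psi> (\<lambda>_. 0)
        \<le> power_functional \<Omega> n \<Gamma>p \<rho> b (\<lambda>_. 0) ?\<alpha> (\<lambda>x. t *\<^sub>R \<psi> x) (\<lambda>_. 0)"
      by (rule min[unfolded minimum_power_theorem_def, rule_format, OF sol adm zero])
    then show ?thesis using power[OF that] power[of 1] by simp
  qed
  have "(P has_real_derivative \<beta> * C / 2) (at 1)"
    unfolding P_def by (auto intro!: derivative_eq_intros simp: field_simps)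
  then have "\<beta> * C / 2 = 0"
    by (rule DERIV_local_min[where d = 1]) (use P_min in \<open>auto simp: abs_if split: if_splits\<close>)
  then show False using \<beta> C_pos by simp
qed

text \<open>A uniform flow at zero pressure dissipates less at the constant pressure \<open>- 1 / \<beta>\<close>, where
  the drag is smaller by the factor \<open>exp (- 1)\<close>.\<close>

lemma barus_no_minimum_power:
  fixes n :: "real ^ 'n \<Rightarrow> real ^ 'n"
  assumes dom: "regular_domain \<Omega> n" and \<rho>: "\<rho> > 0"
    and \<mu>: "\<mu> > 0" and \<beta>: "\<beta> \<noteq> 0"
    and k: "continuous_on (closure \<Omega>) k" "\<And>x. x \<in> closure \<Omega> \<Longrightarrow> k x > 0"
  shows "\<not> minimum_power_theorem \<Omega> n \<Gamma>v \<Gamma>p \<rho> (barus \<mu> \<beta> k)"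
proof
  assume min: "minimum_power_theorem \<Omega> n \<Gamma>v \<Gamma>p \<rho> (barus \<mu> \<beta> k)"
  have op: "open \<Omega>" and bd: "bounded \<Omega>" and ne: "\<Omega> \<noteq> {}"
    using dom by (auto simp: regular_domain_def)
  define e :: "real ^ 'n" where "e = axis undefined 1"
  have e: "e \<bullet> e = 1" by (simp add: e_def inner_axis_axis)
  define I where "I = (LINT x:\<Omega>|lborel. \<mu> / k x)"
  have pos: "\<mu> / k x > 0" if "x \<in> \<Omega>" for x using \<mu> k(2)[of x] that closure_subset[of \<Omega>] by auto
  have "I > 0"
    unfolding I_def
  proof (rule set_integral_pos[OF _ _ op ne order_refl])
    show "set_integrable lborel \<Omega> (\<lambda>x. \<mu> / k x)"
      using k(2) by (intro set_integrable_continuous_on_closure[OF op bd] continuous_intros k(1)) force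
  qed (use pos in \<open>auto intro: less_imp_le\<close>)
  define b where "b x = (1 / \<rho>) *\<^sub>R (barus \<mu> \<beta> k x e 0 *\<^sub>R e)" for x
  have sol: "flow_solution \<Omega> n \<Gamma>v \<Gamma>p \<rho> b (\<lambda>x. e \<bullet> n x) (\<lambda>_. 0) (barus \<mu> \<beta> k) (\<lambda>_. e) (\<lambda>_. 0)"
    unfolding b_def[abs_def] by (rule constant_flow_solution[OF \<rho>])
  have adm: "(\<lambda>_. e) \<in> kinematically_admissible \<Omega> n \<Gamma>v (\<lambda>x. e \<bullet> n x)"
    by (simp add: kinematically_admissible_def velocity_space_def C1_on_closure_const
        divergence_has_derivative[OF has_derivative_const])
  have q: "(\<lambda>_. - 1 / \<beta>) \<in> pressure_space \<Omega>"
    by (simp add: pressure_space_def C1_on_closure_const)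
  have "power_functional \<Omega> n \<Gamma>p \<rho> b (\<lambda>_. 0) (barus \<mu> \<beta> k) (\<lambda>_. e) (\<lambda>_. 0)
      \<le> power_functional \<Omega> n \<Gamma>p \<rho> b (\<lambda>_. 0) (barus \<mu> \<beta> k) (\<lambda>_. e) (\<lambda>_. - 1 / \<beta>)"
    by (rule min[unfolded minimum_power_theorem_def, rule_format, OF sol adm q])
  moreover have "(LINT x:\<Omega>|lborel. 1/2 * barus \<mu> \<beta> k x e q * (e \<bullet> e)) = exp (\<beta> * q) / 2 * I" for q
  proof -
    have "(LINT x:\<Omega>|lborel. 1/2 * barus \<mu> \<beta> k x e q * (e \<bullet> e)) = (LINT x:\<Omega>|lborel. exp (\<beta> * q) / 2 * (\<mu> / k x))"
      by (simp add: barus_def e mult_ac)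
    then show ?thesis unfolding I_def by (simp only: set_integral_mult_right)
  qed
  ultimately have "I \<le> exp (- 1) * I"
    using \<beta> by (simp add: power_functional_def)
  with \<open>I > 0\<close> show False by simp
qed

section \<open>The first variation and the minimum power theorem\<close>

theorem mainTheorem7:
  fixes \<Omega> \<Gamma>v \<Gamma>p :: "(real ^ 'n) set"
    and n :: "real ^ 'n \<Rightarrow> real ^ 'n"
    and \<rho> :: real
  assumes domain: "regular_domain \<Omega> n"
    and boundary: "boundary_partition \<Omega> \<Gamma>v \<Gamma>p"
    and density: "\<rho> > 0"
  shows
    "(\<forall>\<alpha> b vn p\<^sub>0 v p.
       regular_drag \<Omega> \<alpha> \<and> flow_solution \<Omega> n \<Gamma>v \<Gamma>p \<rho> b vn p\<^sub>0 \<alpha> v p \<longrightarrow>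
       (\<forall>\<delta>v\<in>velocity_variations \<Omega> n \<Gamma>v. \<forall>\<delta>p\<in>pressure_space \<Omega>.
          lagrangian_along \<Omega> n \<Gamma>p \<rho> b p\<^sub>0 \<alpha> v p \<delta>v \<delta>p differentiable (at 0) \<and>
          first_variation \<Omega> n \<Gamma>p \<rho> b p\<^sub>0 \<alpha> v p \<delta>v \<delta>p = drag_variation_integral \<Omega> \<alpha> v p \<delta>v \<delta>p) \<and>
       ((\<forall>\<delta>v\<in>velocity_variations \<Omega> n \<Gamma>v. \<forall>\<delta>p\<in>pressure_space \<Omega>.
           drag_variation_integral \<Omega> \<alpha> v p \<delta>v \<delta>p = 0) \<longleftrightarrow>
        (\<forall>x\<in>\<Omega>. v x \<noteq> 0 \<longrightarrow> drag_dv \<alpha> x (v x) (p x) = 0 \<and> drag_dp \<alpha> x (v x) (p x) = 0)) \<and>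
       (necessary_condition \<Omega> n \<Gamma>v \<Gamma>p \<rho> b p\<^sub>0 \<alpha> v p \<longleftrightarrow>
        (\<forall>x\<in>\<Omega>. v x \<noteq> 0 \<longrightarrow> drag_dv \<alpha> x (v x) (p x) = 0 \<and> drag_dp \<alpha> x (v x) (p x) = 0))) \<and>
     (\<forall>\<alpha>. regular_drag \<Omega> \<alpha> \<longrightarrow>
       ((\<forall>b vn p\<^sub>0 v p. flow_solution \<Omega> n \<Gamma>v \<Gamma>p \<rho> b vn p\<^sub>0 \<alpha> v p \<longrightarrow>
           necessary_condition \<Omega> n \<Gamma>v \<Gamma>p \<rho> b p\<^sub>0 \<alpha> v p) \<longleftrightarrow>
        (\<forall>x\<in>\<Omega>. \<forall>w q w' q'. \<alpha> x w q = \<alpha> x w' q'))) \<and>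
     (\<forall>\<mu> \<beta> k. \<mu> > 0 \<and> \<beta> \<noteq> 0 \<and> continuous_on (closure \<Omega>) k \<and> (\<forall>x\<in>closure \<Omega>. k x > 0) \<longrightarrow>
       (\<forall>b vn p\<^sub>0 v p.
          flow_solution \<Omega> n \<Gamma>v \<Gamma>p \<rho> b vn p\<^sub>0 (darcy_forchheimer \<mu> \<beta> k) v p \<and> (\<exists>x\<in>\<Omega>. v x \<noteq> 0) \<longrightarrow>
          \<not> necessary_condition \<Omega> n \<Gamma>v \<Gamma>p \<rho> b p\<^sub>0 (darcy_forchheimer \<mu> \<beta> k) v p) \<and>
       (2 \<le> CARD('n) \<longrightarrow> \<not> minimum_power_theorem \<Omega> n \<Gamma>v \<Gamma>p \<rho> (darcy_forchheimer \<mu> \<beta> k))) \<and>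
     (\<forall>\<mu>\<^sub>0 \<beta> k. \<mu>\<^sub>0 > 0 \<and> \<beta> \<noteq> 0 \<and> continuous_on (closure \<Omega>) k \<and> (\<forall>x\<in>closure \<Omega>. k x > 0) \<longrightarrow>
       (\<forall>b vn p\<^sub>0 v p.
          flow_solution \<Omega> n \<Gamma>v \<Gamma>p \<rho> b vn p\<^sub>0 (barus \<mu>\<^sub>0 \<beta> k) v p \<and> (\<exists>x\<in>\<Omega>. v x \<noteq> 0) \<longrightarrow>
          \<not> necessary_condition \<Omega> n \<Gamma>v \<Gamma>p \<rho> b p\<^sub>0 (barus \<mu>\<^sub>0 \<beta> k) v p) \<and>
       \<not> minimum_power_theorem \<Omega> n \<Gamma>v \<Gamma>p \<rho> (barus \<mu>\<^sub>0 \<beta> k))"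
proof (intro conjI)
  have bd: "bounded \<Omega>" using domain by (simp add: regular_domain_def)
  have cl: "\<Omega> \<subseteq> closure \<Omega>" by (rule closure_subset)
  show "\<forall>\<alpha> b vn p\<^sub>0 v p.
       regular_drag \<Omega> \<alpha> \<and> flow_solution \<Omega> n \<Gamma>v \<Gamma>p \<rho> b vn p\<^sub>0 \<alpha> v p \<longrightarrow>
       (\<forall>\<delta>v\<in>velocity_variations \<Omega> n \<Gamma>v. \<forall>\<delta>p\<in>pressure_space \<Omega>.
          lagrangian_along \<Omega> n \<Gamma>p \<rho> b p\<^sub>0 \<alpha> v p \<delta>v \<delta>p differentiable (at 0) \<and>
          first_variation \<Omega> n \<Gamma>p \<rho> b p\<^sub>0 \<alpha> v p \<delta>v \<delta>p = drag_variation_integral \<Omega> \<alpha> v p \<delta>v \<delta>p) \<and>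
       ((\<forall>\<delta>v\<in>velocity_variations \<Omega> n \<Gamma>v. \<forall>\<delta>p\<in>pressure_space \<Omega>.
           drag_variation_integral \<Omega> \<alpha> v p \<delta>v \<delta>p = 0) \<longleftrightarrow>
        (\<forall>x\<in>\<Omega>. v x \<noteq> 0 \<longrightarrow> drag_dv \<alpha> x (v x) (p x) = 0 \<and> drag_dp \<alpha> x (v x) (p x) = 0)) \<and>
       (necessary_condition \<Omega> n \<Gamma>v \<Gamma>p \<rho> b p\<^sub>0 \<alpha> v p \<longleftrightarrow>
        (\<forall>x\<in>\<Omega>. v x \<noteq> 0 \<longrightarrow> drag_dv \<alpha> x (v x) (p x) = 0 \<and> drag_dp \<alpha> x (v x) (p x) = 0))"
  proof (intro allI impI, elim conjE, intro conjI ballI)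
    fix \<alpha> b vn p\<^sub>0 v p
    assume reg: "regular_drag \<Omega> \<alpha>" and sol: "flow_solution \<Omega> n \<Gamma>v \<Gamma>p \<rho> b vn p\<^sub>0 \<alpha> v p"
    have C1: "C1_on_closure \<Omega> v" "C1_on_closure \<Omega> p" using sol by (simp_all add: flow_solution_def)
    {
      fix \<delta>v \<delta>p assume var: "\<delta>v \<in> velocity_variations \<Omega> n \<Gamma>v" "\<delta>p \<in> pressure_space \<Omega>"
      note der = lagrangian_derivative[OF domain boundary reg sol var]
      show "lagrangian_along \<Omega> n \<Gamma>p \<rho> b p\<^sub>0 \<alpha> v p \<delta>v \<delta>p differentiable (at 0)"
        using der by (auto simp: real_differentiable_def)
      show "first_variation \<Omega> n \<Gamma>p \<rho> b p\<^sub>0 \<alpha> v p \<delta>v \<delta>p = drag_variation_integral \<Omega> \<alpha> v p \<delta>v \<delta>p"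
        unfolding first_variation_def using der by (rule DERIV_imp_deriv)
    }
    show "(\<forall>\<delta>v\<in>velocity_variations \<Omega> n \<Gamma>v. \<forall>\<delta>p\<in>pressure_space \<Omega>.
           drag_variation_integral \<Omega> \<alpha> v p \<delta>v \<delta>p = 0) \<longleftrightarrow>
        (\<forall>x\<in>\<Omega>. v x \<noteq> 0 \<longrightarrow> drag_dv \<alpha> x (v x) (p x) = 0 \<and> drag_dp \<alpha> x (v x) (p x) = 0)"
      by (rule drag_variation_integral_vanishes_iff[OF domain boundary reg C1])
    show "necessary_condition \<Omega> n \<Gamma>v \<Gamma>p \<rho> b p\<^sub>0 \<alpha> v p \<longleftrightarrow>
        (\<forall>x\<in>\<Omega>. v x \<noteq> 0 \<longrightarrow> drag_dv \<alpha> x (v x) (p x) = 0 \<and> drag_dp \<alpha> x (v x) (p x) = 0)"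
      by (rule necessary_condition_iff[OF domain boundary reg sol])
  qed
  show "\<forall>\<alpha>. regular_drag \<Omega> \<alpha> \<longrightarrow>
       ((\<forall>b vn p\<^sub>0 v p. flow_solution \<Omega> n \<Gamma>v \<Gamma>p \<rho> b vn p\<^sub>0 \<alpha> v p \<longrightarrow>
           necessary_condition \<Omega> n \<Gamma>v \<Gamma>p \<rho> b p\<^sub>0 \<alpha> v p) \<longleftrightarrow>
        (\<forall>x\<in>\<Omega>. \<forall>w q w' q'. \<alpha> x w q = \<alpha> x w' q'))"
    by (intro allI impI necessary_condition_for_all_data_iff[OF domain boundary density])
  show "\<forall>\<mu> \<beta> k. \<mu> > 0 \<and> \<beta> \<noteq> 0 \<and> continuous_on (closure \<Omega>) k \<and> (\<forall>x\<in>closure \<Omega>. k x > 0) \<longrightarrow>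
       (\<forall>b vn p\<^sub>0 v p.
          flow_solution \<Omega> n \<Gamma>v \<Gamma>p \<rho> b vn p\<^sub>0 (darcy_forchheimer \<mu> \<beta> k) v p \<and> (\<exists>x\<in>\<Omega>. v x \<noteq> 0) \<longrightarrow>
          \<not> necessary_condition \<Omega> n \<Gamma>v \<Gamma>p \<rho> b p\<^sub>0 (darcy_forchheimer \<mu> \<beta> k) v p) \<and>
       (2 \<le> CARD('n) \<longrightarrow> \<not> minimum_power_theorem \<Omega> n \<Gamma>v \<Gamma>p \<rho> (darcy_forchheimer \<mu> \<beta> k))"
  proof (intro allI impI, elim conjE, rule conjI, intro allI impI, elim conjE bexE)
    fix \<mu> \<beta> :: real and k :: "real ^ 'n \<Rightarrow> real" and b vn p\<^sub>0 v p x
    assume \<mu>: "\<mu> > 0" and \<beta>: "\<beta> \<noteq> 0" and k: "continuous_on (closure \<Omega>) k" "\<forall>x\<in>closure \<Omega>. k x > 0"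
      and sol: "flow_solution \<Omega> n \<Gamma>v \<Gamma>p \<rho> b vn p\<^sub>0 (darcy_forchheimer \<mu> \<beta> k) v p"
      and x: "x \<in> \<Omega>" "v x \<noteq> 0"
    have xc: "x \<in> closure \<Omega>" using x cl by blast
    have "drag_dv (darcy_forchheimer \<mu> \<beta> k) x (v x) (p x) \<bullet> v x = \<mu> / k x * \<beta> * norm (v x)"
      by (rule drag_dv_darcy_forchheimer[OF bd k(1) k(2)[rule_format] xc x(2)])
    also have "\<dots> \<noteq> 0" using \<mu> \<beta> x(2) k(2)[rule_format, OF xc] by simp
    finally have "drag_dv (darcy_forchheimer \<mu> \<beta> k) x (v x) (p x) \<noteq> 0" by auto
    then show "\<not> necessary_condition \<Omega> n \<Gamma>v \<Gamma>p \<rho> b p\<^sub>0 (darcy_forchheimer \<mu> \<beta> k) v p"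
      using x
      by (subst necessary_condition_iff[OF domain boundary
            regular_drag_darcy_forchheimer[OF bd k(1) k(2)[rule_format]] sol]) auto
  next
    fix \<mu> \<beta> :: real and k :: "real ^ 'n \<Rightarrow> real"
    assume \<mu>: "\<mu> > 0" and \<beta>: "\<beta> \<noteq> 0" and k: "continuous_on (closure \<Omega>) k" "\<forall>x\<in>closure \<Omega>. k x > 0"
    show "2 \<le> CARD('n) \<longrightarrow> \<not> minimum_power_theorem \<Omega> n \<Gamma>v \<Gamma>p \<rho> (darcy_forchheimer \<mu> \<beta> k)"
      by (intro impI darcy_forchheimer_no_minimum_power[OF domain boundary density \<mu> \<beta> k(1) k(2)[rule_format]])
  qed
  show "\<forall>\<mu>\<^sub>0 \<beta> k. \<mu>\<^sub>0 > 0 \<and> \<beta> \<noteq> 0 \<and> continuous_on (closure \<Omega>) k \<and> (\<forall>x\<in>closure \<Omega>. k x > 0) \<longrightarrow>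
       (\<forall>b vn p\<^sub>0 v p.
          flow_solution \<Omega> n \<Gamma>v \<Gamma>p \<rho> b vn p\<^sub>0 (barus \<mu>\<^sub>0 \<beta> k) v p \<and> (\<exists>x\<in>\<Omega>. v x \<noteq> 0) \<longrightarrow>
          \<not> necessary_condition \<Omega> n \<Gamma>v \<Gamma>p \<rho> b p\<^sub>0 (barus \<mu>\<^sub>0 \<beta> k) v p) \<and>
       \<not> minimum_power_theorem \<Omega> n \<Gamma>v \<Gamma>p \<rho> (barus \<mu>\<^sub>0 \<beta> k)"
  proof (intro allI impI, elim conjE, rule conjI, intro allI impI, elim conjE bexE)
    fix \<mu> \<beta> :: real and k :: "real ^ 'n \<Rightarrow> real" and b vn p\<^sub>0 v p x
    assume \<mu>: "\<mu> > 0" and \<beta>: "\<beta> \<noteq> 0" and k: "continuous_on (closure \<Omega>) k" "\<forall>x\<in>closure \<Omega>. k x > 0"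
      and sol: "flow_solution \<Omega> n \<Gamma>v \<Gamma>p \<rho> b vn p\<^sub>0 (barus \<mu> \<beta> k) v p"
      and x: "x \<in> \<Omega>" "v x \<noteq> 0"
    have xc: "x \<in> closure \<Omega>" using x cl by blast
    have "drag_dp (barus \<mu> \<beta> k) x (v x) (p x) = \<mu> / k x * \<beta> * exp (\<beta> * p x)"
      by (rule drag_dp_barus[OF bd k(1) k(2)[rule_format]])
    also have "\<dots> \<noteq> 0" using \<mu> \<beta> k(2)[rule_format, OF xc] by simp
    finally show "\<not> necessary_condition \<Omega> n \<Gamma>v \<Gamma>p \<rho> b p\<^sub>0 (barus \<mu> \<beta> k) v p"
      using x
      by (subst necessary_condition_iff[OF domain boundary
            regular_drag_barus[OF bd k(1) k(2)[rule_format]] sol]) auto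
  next
    fix \<mu> \<beta> :: real and k :: "real ^ 'n \<Rightarrow> real"
    assume \<mu>: "\<mu> > 0" and \<beta>: "\<beta> \<noteq> 0" and k: "continuous_on (closure \<Omega>) k" "\<forall>x\<in>closure \<Omega>. k x > 0"
    show "\<not> minimum_power_theorem \<Omega> n \<Gamma>v \<Gamma>p \<rho> (barus \<mu> \<beta> k)"
      by (rule barus_no_minimum_power[OF domain density \<mu> \<beta> k(1) k(2)[rule_format]])
  qed
qed

end
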